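(* Let $\mathfrak{g}$ be a five-dimensional Lie algebra of vector fields in the plane whose commutator $\mathfrak{g}'=[\mathfrak{g},\mathfrak{g}]$ is abelian and of rank $1$. Assume that $\mathfrak{g}'$ has an abelian complement $A$ in $\mathfrak{g}$. Assume also that the weights of $\mathfrak{g}/\mathfrak{g}'$ on $\mathfrak{g}'$ with respect to an ordered basis $(\bar e_1,\bar e_2)$ of $\mathfrak{g}/\mathfrak{g}'$, with $e_1,e_2\in A$, are $(0,k)$, $(\lambda,k)$, $(\mu,k)$ with $k,\lambda,\mu\neq 0$ and $\lambda\neq\mu$, with weight vectors $e_3,e_4,e_5$ respectively. Moreover, assume that if $w$ is the weight vector of weight $(0,k)$, then $\langle Z_A(w),w\rangle$ is of rank $2$. Then, in the canonical coordinates $(x,y)$ for $\langle Z_A(w),w\rangle$, the algebra is $$\mathfrak{g}=\langle \partial_x,\ y\partial_y\rangle\oplus\langle \partial_y,\ e^{\lambda x}\partial_y,\ e^{\mu x}\partial_y\rangle .$$ The generic $\mathfrak{g}$-orbit in the extended space $(x,y,y',y'',y''')$ is five-dimensional, and the points with lower-dimensional orbits are those which satisfy the equation $$y'''-(\lambda+\mu)y''+\lambda\mu\, y'=0 .$$ Moreover, in these coordinates this is the only hypersurface invariant under $\mathfrak{g}$.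
   Context: All Lie algebras are real and $k,\lambda,\mu$ are real numbers; vector fields are local and coordinates are introduced locally near generic points. The symbol $\oplus$ denotes a direct sum of vector spaces. Rank: the rank of a Lie algebra of vector fields is the dimension of its generic orbit. Weights: since $\mathfrak{g}'$ is abelian, the adjoint action of $\mathfrak{g}$ on $\mathfrak{g}'$ factors through $\mathfrak{g}/\mathfrak{g}'$. Here $\bar e_i$ is the class of $e_i$ in $\mathfrak{g}/\mathfrak{g}'$, and a vector $v\in\mathfrak{g}'$ has weight $(a,b)$ if $[e_1,v]=a\,v$ and $[e_2,v]=b\,v$. $Z_A(w)$ denotes the centralizer of $w$ in $A$. Canonical coordinates for $\langle Z_A(w),w\rangle$: here $Z_A(w)=\langle e_1\rangle$ and $w=e_3$, and canonical coordinates are local coordinates $(x,y)$ in which $e_1=\partial_x$ and $w=\partial_y$ (such coordinates are determined only up to translations). Extended space and prolongation: $\mathfrak{g}$ acts on the space with coordinates $(x,y,y',y'',y''')$ by third prolongations. For $Z=\xi(x,y)\partial_x+\eta(x,y)\partial_y$, the third prolongation is $Z^{(3)}=\xi\partial_x+\eta\partial_y+\sum_{j=1}^3\eta^{(j)}\partial_{y^{(j)}}$, where $\eta^{(0)}=\eta$, $\eta^{(j)}=D\eta^{(j-1)}-y^{(j)}D\xi$ and $D=\partial_x+y'\partial_y+y''\partial_{y'}+\cdots$ is the total derivative. Orbits in the extended space are those of the Lie algebra of third prolongations of elements of $\mathfrak{g}$. A hypersurface in the extended space is invariant under $\mathfrak{g}$ if the third prolongation of every element of $\mathfrak{g}$ is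 tangent to it.
   Formalization: Vector fields are smooth, and a field of the Lie algebra that vanishes on a nonempty open set is assumed to be zero (automatic for analytic fields on a connected domain); otherwise the algebra could fail to be five-dimensional near some generic points and the claim would be false there. *)

theory Defs
  imports "HOL-Analysis.Analysis" "HOL-Library.Function_Algebras"
begin

text \<open>Vector fields are functions \<open>'a \<Rightarrow> 'a\<close>. The pointwise vector space structure makes
  \<^const>\<open>span\<close>, \<^const>\<open>subspace\<close> and \<^const>\<open>dim\<close> available for them.\<close>

instantiation "fun" :: (type, real_vector) real_vector
begin

definition scaleR_fun :: "real \<Rightarrow> ('a \<Rightarrow> 'b) \<Rightarrow> 'a \<Rightarrow> 'b"
  where "scaleR_fun c f = (\<lambda>x. c *\<^sub>R f x)"

instance
  by standard (simp_all add: scaleR_fun_def plus_fun_def algebra_simps)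

end


section \<open>Smooth maps, submanifolds\<close>

primrec Ck_on :: "nat \<Rightarrow> ('a::real_normed_vector \<Rightarrow> 'b::real_normed_vector) \<Rightarrow> 'a set \<Rightarrow> bool"
  where
    "Ck_on 0 f U \<longleftrightarrow> continuous_on U f"
  | "Ck_on (Suc n) f U \<longleftrightarrow>
       (\<forall>x\<in>U. f differentiable at x) \<and> (\<forall>v. Ck_on n (\<lambda>x. frechet_derivative f (at x) v) U)"

text \<open>Only used for open \<open>U\<close>.\<close>

definition smooth_on :: "('a::real_normed_vector \<Rightarrow> 'b::real_normed_vector) \<Rightarrow> 'a set \<Rightarrow> bool"
  where "smooth_on f U \<longleftrightarrow> (\<forall>n. Ck_on n f U)"

definition diffeo_on :: "'a::euclidean_space set \<Rightarrow> ('a \<Rightarrow> 'b::euclidean_space) \<Rightarrow> bool"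
  where "diffeo_on W \<phi> \<longleftrightarrow> open W \<and> open (\<phi> ` W) \<and> inj_on \<phi> W \<and>
           smooth_on \<phi> W \<and> smooth_on (inv_into W \<phi>) (\<phi> ` W)"

text \<open>Embedded submanifolds of a Euclidean space, through slice charts.\<close>

definition submanifold :: "nat \<Rightarrow> 'a::euclidean_space set \<Rightarrow> bool"
  where "submanifold d N \<longleftrightarrow>
    (\<forall>p\<in>N. \<exists>W (\<Phi> :: 'a \<Rightarrow> 'a) V. p \<in> W \<and> diffeo_on W \<Phi> \<and> subspace V \<and> dim V = d \<and>
       \<Phi> ` (W \<inter> N) = V \<inter> \<Phi> ` W)"

definition tangent_space :: "'a::euclidean_space set \<Rightarrow> 'a \<Rightarrow> 'a set"
  where "tangent_space N p =
    {v. \<exists>\<gamma> :: real \<Rightarrow> 'a. \<gamma> 0 = p \<and> (\<forall>\<^sub>F t in at 0. \<gamma> t \<in> N) \<and> (\<gamma> has_vector_derivative v) (at 0)}"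

definition hypersurface_in :: "'a::euclidean_space set \<Rightarrow> 'a set \<Rightarrow> bool"
  where "hypersurface_in M H \<longleftrightarrow> H \<subseteq> M \<and> H \<noteq> {} \<and> submanifold (DIM('a) - 1) H"


section \<open>Lie algebras of vector fields\<close>

text \<open>A vector field on an open set \<open>M\<close> is extended by \<open>0\<close> outside \<open>M\<close>, so that two fields on
  \<open>M\<close> are equal as functions iff they agree on \<open>M\<close>.\<close>

definition restrict0 :: "'a set \<Rightarrow> ('a \<Rightarrow> 'b::zero) \<Rightarrow> 'a \<Rightarrow> 'b"
  where "restrict0 M X = (\<lambda>p. if p \<in> M then X p else 0)"

definition lie_bracket ::
    "'a::euclidean_space set \<Rightarrow> ('a \<Rightarrow> 'a) \<Rightarrow> ('a \<Rightarrow> 'a) \<Rightarrow> 'a \<Rightarrow> 'a"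
  where "lie_bracket M X Y =
    restrict0 M (\<lambda>p. frechet_derivative Y (at p) (X p) - frechet_derivative X (at p) (Y p))"

text \<open>In a Lie algebra of local vector fields a field is determined by its germ at any point
  of \<open>M\<close>: this is the last condition. It is automatic for analytic fields on a
  connected \<open>M\<close>. For merely smooth fields it ensures that dimensions and linear independence do
  not change when one passes to a smaller open set.\<close>

definition lie_algebra_of_fields :: "'a::euclidean_space set \<Rightarrow> ('a \<Rightarrow> 'a) set \<Rightarrow> bool"
  where "lie_algebra_of_fields M L \<longleftrightarrow>
    open M \<and> M \<noteq> {} \<and> subspace L \<and>
    (\<forall>X\<in>L. smooth_on X M \<and> (\<forall>p. p \<notin> M \<longrightarrow> X p = 0)) \<and>
    (\<forall>X\<in>L. \<forall>Y\<in>L. lie_bracket M X Y \<in> L) \<and>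
    (\<forall>X\<in>L. \<forall>V. open V \<and> V \<noteq> {} \<and> V \<subseteq> M \<and> (\<forall>p\<in>V. X p = 0) \<longrightarrow> X = 0)"

definition derived_algebra :: "'a::euclidean_space set \<Rightarrow> ('a \<Rightarrow> 'a) set \<Rightarrow> ('a \<Rightarrow> 'a) set"
  where "derived_algebra M L = span {lie_bracket M X Y | X Y. X \<in> L \<and> Y \<in> L}"

definition abelian_fields :: "'a::euclidean_space set \<Rightarrow> ('a \<Rightarrow> 'a) set \<Rightarrow> bool"
  where "abelian_fields M A \<longleftrightarrow> (\<forall>X\<in>A. \<forall>Y\<in>A. lie_bracket M X Y = 0)"

definition centralizer ::
    "'a::euclidean_space set \<Rightarrow> ('a \<Rightarrow> 'a) set \<Rightarrow> ('a \<Rightarrow> 'a) \<Rightarrow> ('a \<Rightarrow> 'a) set"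
  where "centralizer M A w = {X \<in> A. lie_bracket M X w = 0}"

definition is_direct_sum :: "'v::real_vector set \<Rightarrow> 'v set \<Rightarrow> 'v set \<Rightarrow> bool"
  where "is_direct_sum L A B \<longleftrightarrow>
    subspace A \<and> subspace B \<and> A \<inter> B = {0} \<and> L = {a + b | a b. a \<in> A \<and> b \<in> B}"

text \<open>The classes of \<open>u\<close>, \<open>v\<close> form an ordered basis of the quotient space \<open>L/D\<close>.\<close>

definition quotient_basis :: "'v::real_vector set \<Rightarrow> 'v set \<Rightarrow> 'v \<Rightarrow> 'v \<Rightarrow> bool"
  where "quotient_basis L D u v \<longleftrightarrow> u \<in> L \<and> v \<in> L \<and>
    (\<forall>X\<in>L. \<exists>!c :: real \<times> real. X - (fst c *\<^sub>R u + snd c *\<^sub>R v) \<in> D)"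

definition weight_vector ::
    "'a::euclidean_space set \<Rightarrow> ('a \<Rightarrow> 'a) set \<Rightarrow> ('a \<Rightarrow> 'a) \<Rightarrow> ('a \<Rightarrow> 'a) \<Rightarrow>
     real \<times> real \<Rightarrow> ('a \<Rightarrow> 'a) \<Rightarrow> bool"
  where "weight_vector M D u1 u2 wt v \<longleftrightarrow> v \<in> D \<and> v \<noteq> 0 \<and>
    lie_bracket M u1 v = fst wt *\<^sub>R v \<and> lie_bracket M u2 v = snd wt *\<^sub>R v"


section \<open>Orbits and rank\<close>

text \<open>Since vector fields are local, orbits are local as well: a (piece of an) orbit is a connected
  submanifold \<open>N\<close> of \<open>M\<close> whose tangent space at each of its points consists of the values of
  the fields.\<close>

definition local_orbit :: "'a::euclidean_space set \<Rightarrow> ('a \<Rightarrow> 'a) set \<Rightarrow> nat \<Rightarrow> 'a set \<Rightarrow> bool"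
  where "local_orbit M L d N \<longleftrightarrow>
    N \<subseteq> M \<and> connected N \<and> submanifold d N \<and> (\<forall>q\<in>N. tangent_space N q = (\<lambda>X. X q) ` L)"

definition orbit_has_dim :: "'a::euclidean_space set \<Rightarrow> ('a \<Rightarrow> 'a) set \<Rightarrow> 'a \<Rightarrow> nat \<Rightarrow> bool"
  where "orbit_has_dim M L p d \<longleftrightarrow> (\<exists>N. p \<in> N \<and> local_orbit M L d N)"

text \<open>``Generic'' means: on a dense open subset.\<close>

definition generic_in :: "'a::topological_space set \<Rightarrow> ('a \<Rightarrow> bool) \<Rightarrow> bool"
  where "generic_in M P \<longleftrightarrow> (\<exists>G. open G \<and> G \<subseteq> M \<and> M \<subseteq> closure G \<and> (\<forall>p\<in>G. P p))"

definition has_rank :: "'a::euclidean_space set \<Rightarrow> ('a \<Rightarrow> 'a) set \<Rightarrow> nat \<Rightarrow> bool"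
  where "has_rank M L r \<longleftrightarrow> generic_in M (\<lambda>p. orbit_has_dim M L p r)"


section \<open>Coordinates on the plane\<close>

type_synonym plane = "real \<times> real"

definition push_field :: "plane set \<Rightarrow> (plane \<Rightarrow> plane) \<Rightarrow> (plane \<Rightarrow> plane) \<Rightarrow> plane \<Rightarrow> plane"
  where "push_field W \<phi> X =
    restrict0 (\<phi> ` W) (\<lambda>q. let p = inv_into W \<phi> q in frechet_derivative \<phi> (at p) (X p))"

text \<open>Coordinates \<open>\<phi> = (x, y)\<close> on a connected open \<open>W \<subseteq> M\<close> in which \<open>u = \<partial>\<^sub>x\<close> and \<open>w = \<partial>\<^sub>y\<close>.\<close>

definition canonical_coordinates ::
    "plane set \<Rightarrow> (plane \<Rightarrow> plane) \<Rightarrow> (plane \<Rightarrow> plane) \<Rightarrow> plane set \<Rightarrow> (plane \<Rightarrow> plane) \<Rightarrow> bool"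
  where "canonical_coordinates M u w W \<phi> \<longleftrightarrow>
    W \<noteq> {} \<and> W \<subseteq> M \<and> connected W \<and> diffeo_on W \<phi> \<and>
    push_field W \<phi> u = restrict0 (\<phi> ` W) (\<lambda>_. (1, 0)) \<and>
    push_field W \<phi> w = restrict0 (\<phi> ` W) (\<lambda>_. (0, 1))"


section \<open>Third prolongation\<close>

text \<open>Points of the extended space are tuples \<open>(x, y, y', y'', y''')\<close>.\<close>

type_synonym jet = "real \<times> real \<times> real \<times> real \<times> real"

definition jet_space :: "plane set \<Rightarrow> jet set"
  where "jet_space U = {(x, y, y1, y2, y3). (x, y) \<in> U}"

fun jet_coord :: "nat \<Rightarrow> jet \<Rightarrow> real"
  where "jet_coord j (x, y, y1, y2, y3) = [y, y1, y2, y3] ! j"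

text \<open>The total derivative. The term \<open>y''''\<partial>\<^bsub>y'''\<^esub>\<close> is omitted: the operator is only applied to
  functions that do not depend on \<open>y'''\<close>.\<close>

fun total_deriv :: "(jet \<Rightarrow> real) \<Rightarrow> jet \<Rightarrow> real"
  where "total_deriv f (x, y, y1, y2, y3) =
    frechet_derivative f (at (x, y, y1, y2, y3)) (1, y1, y2, y3, 0)"

definition xi :: "(plane \<Rightarrow> plane) \<Rightarrow> jet \<Rightarrow> real"
  where "xi Z = (\<lambda>(x, y, _). fst (Z (x, y)))"

primrec eta :: "(plane \<Rightarrow> plane) \<Rightarrow> nat \<Rightarrow> jet \<Rightarrow> real"
  where
    "eta Z 0 = (\<lambda>(x, y, _). snd (Z (x, y)))"
  | "eta Z (Suc j) =
       (\<lambda>p. total_deriv (eta Z j) p - jet_coord (Suc j) p * total_deriv (xi Z) p)"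

definition prolong3 :: "plane set \<Rightarrow> (plane \<Rightarrow> plane) \<Rightarrow> jet \<Rightarrow> jet"
  where "prolong3 U Z =
    restrict0 (jet_space U) (\<lambda>p. (xi Z p, eta Z 0 p, eta Z 1 p, eta Z 2 p, eta Z 3 p))"

definition invariant_hypersurface :: "plane set \<Rightarrow> (plane \<Rightarrow> plane) set \<Rightarrow> jet set \<Rightarrow> bool"
  where "invariant_hypersurface U L H \<longleftrightarrow> hypersurface_in (jet_space U) H \<and>
    (\<forall>Z\<in>L. \<forall>p\<in>H. prolong3 U Z p \<in> tangent_space H p)"

end

theory Submission
  imports Defs
begin

text \<open>Canonical coordinates exist near every point where \<open>e1\<close> and \<open>e3\<close> are independent, because
  these two fields commute: the dual coframe of a commuting frame is closed, so it has a local
  primitive, and this primitive is the coordinate map (\<open>canonical_coordinates_exist\<close>). The rank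
  assumption on \<open>\<langle>Z\<^sub>A(w), w\<rangle>\<close> says that the independence holds on a dense open set, as
  \<open>Z\<^sub>A(w) = \<langle>e1\<rangle>\<close>.

  In such coordinates the structure constants become differential equations with constant
  coefficients on a connected domain. A weight vector \<open>X\<close> of \<open>\<gg>'\<close> satisfies \<open>X\<^sub>x = a X\<close>, \<open>X\<^sub>y = 0\<close>,
  so it is \<open>e\<^bsup>ax\<^esup>\<close> times a constant vector, and that vector is vertical because \<open>\<gg>'\<close> has rank one.
  Similarly \<open>e2\<close> is \<open>(c - k y) \<partial>\<^sub>y\<close>. Since \<open>e1, \<dots>, e5\<close> span \<open>\<gg>\<close>, this determines the algebra
  (\<open>push_algebra_eq_model\<close>).

  Let \<open>\<omega> = y''' - (\<lambda> + \<mu>) y'' + \<lambda>\<mu> y'\<close>, a linear form on the extended space. The functions \<open>1\<close>,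
  \<open>e\<^bsup>\<lambda>x\<^esup>\<close>, \<open>e\<^bsup>\<mu>x\<^esup>\<close> span the solutions of \<open>\<omega> = 0\<close>; hence at every point the prolongations of all
  generators but \<open>y \<partial>\<^sub>y\<close> span the kernel of \<open>\<omega>\<close>, which is four-dimensional. The prolongation of
  \<open>y \<partial>\<^sub>y\<close> is the vector \<open>(0, y, y', y'', y''')\<close>, and it lies in this kernel iff the point satisfies
  \<open>\<omega> = 0\<close> (\<open>prolongation_values\<close>). So the orbits are open off the hypersurface \<open>S\<close> defined by
  \<open>\<omega> = 0\<close>, and pieces of \<open>S\<close> on it. An invariant hypersurface cannot pass through a point where
  the fields span all directions, so it is contained in \<open>S\<close>; by invariance of domain it is open in
  \<open>S\<close>, and \<open>S\<close> is connected.\<close>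

section \<open>Calculus of \<open>C\<^sup>n\<close> maps\<close>

lemma frechet_derivative_eqI:
  assumes "(f has_derivative f') (at x)"
  shows "frechet_derivative f (at x) = f'"
  using frechet_derivative_at[OF assms] by simp

lemma has_derivative_frechet:
  "f differentiable at x \<Longrightarrow> (f has_derivative frechet_derivative f (at x)) (at x)"
  by (simp add: frechet_derivative_works)

lemma Ck_on_cong:
  assumes "open U" "\<And>x. x \<in> U \<Longrightarrow> f x = g x" "Ck_on n f U"
  shows "Ck_on n g U"
  using assms(2,3)
proof (induction n arbitrary: f g)
  case 0
  then show ?case by (auto intro: continuous_on_eq)
next
  case (Suc n)
  have der: "(g has_derivative frechet_derivative f (at x)) (at x)" if x: "x \<in> U" for x
  proof -
    have "(f has_derivative frechet_derivative f (at x)) (at x)"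
      using Suc.prems(2) x by (intro has_derivative_frechet) simp
    then show ?thesis
      by (rule has_derivative_transform_within_open[OF _ assms(1) x]) (rule Suc.prems(1))
  qed
  have "Ck_on n (\<lambda>x. frechet_derivative g (at x) v) U" for v
    by (rule Suc.IH[where f = "\<lambda>x. frechet_derivative f (at x) v"])
       (use Suc.prems(2) frechet_derivative_eqI[OF der] in auto)
  then show ?case using der by (auto simp: differentiable_def)
qed

lemma Ck_on_Suc_intro:
  assumes "open U" and der: "\<And>x. x \<in> U \<Longrightarrow> (f has_derivative f' x) (at x)"
    and Ck: "\<And>v. Ck_on n (\<lambda>x. f' x v) U"
  shows "Ck_on (Suc n) f U"
proof -
  have "Ck_on n (\<lambda>x. frechet_derivative f (at x) v) U" for v
    by (rule Ck_on_cong[OF assms(1) _ Ck[of v]]) (simp add: frechet_derivative_eqI[OF der])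
  then show ?thesis using der by (auto simp: differentiable_def)
qed

lemma Ck_on_Suc_has_derivative:
  "Ck_on (Suc n) f U \<Longrightarrow> x \<in> U \<Longrightarrow> (f has_derivative frechet_derivative f (at x)) (at x)"
  by (simp add: has_derivative_frechet)

lemma Ck_on_SucD: "Ck_on (Suc n) f U \<Longrightarrow> Ck_on n f U"
proof (induction n arbitrary: f)
  case 0
  then show ?case
    by (auto intro!: continuous_at_imp_continuous_on differentiable_imp_continuous_within)
next
  case (Suc n)
  then show ?case by simp
qed

lemma Ck_on_subset: "Ck_on n f U \<Longrightarrow> V \<subseteq> U \<Longrightarrow> Ck_on n f V"
  by (induction n arbitrary: f) (auto intro: continuous_on_subset)

lemma Ck_on_const: "open U \<Longrightarrow> Ck_on n (\<lambda>x. c) U"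
proof (induction n arbitrary: c)
  case (Suc n)
  then show ?case
    by (intro Ck_on_Suc_intro[where f' = "\<lambda>_ _. 0"]) auto
qed auto

lemma Ck_on_bounded_linear: "open U \<Longrightarrow> bounded_linear f \<Longrightarrow> Ck_on n f U"
proof (cases n)
  case (Suc m)
  assume "open U" "bounded_linear f"
  then show ?thesis unfolding Suc
    by (intro Ck_on_Suc_intro[where f' = "\<lambda>_. f"])
       (auto intro: bounded_linear_imp_has_derivative Ck_on_const)
qed (auto intro: linear_continuous_on)

lemma Ck_on_add: "open U \<Longrightarrow> Ck_on n f U \<Longrightarrow> Ck_on n g U \<Longrightarrow> Ck_on n (\<lambda>x. f x + g x) U"
proof (induction n arbitrary: f g)
  case 0
  then show ?case by (auto intro: continuous_on_add)
next
  case (Suc n)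
  show ?case
    by (rule Ck_on_Suc_intro[OF Suc.prems(1)
          has_derivative_add[OF Ck_on_Suc_has_derivative[OF Suc.prems(2)]
            Ck_on_Suc_has_derivative[OF Suc.prems(3)]]])
       (use Suc in auto)
qed

lemma Ck_on_sum:
  "open U \<Longrightarrow> (\<And>i. i \<in> I \<Longrightarrow> Ck_on n (f i) U) \<Longrightarrow> Ck_on n (\<lambda>x. \<Sum>i\<in>I. f i x) U"
  by (induction I rule: infinite_finite_induct) (auto intro: Ck_on_const Ck_on_add)

lemma Ck_on_bilinear:
  assumes "bounded_bilinear b" "open U" "Ck_on n f U" "Ck_on n g U"
  shows "Ck_on n (\<lambda>x. b (f x) (g x)) U"
  using assms(3,4)
proof (induction n arbitrary: f g)
  case 0
  then show ?case using bounded_bilinear.continuous_on[OF assms(1)] by auto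
next
  case (Suc n)
  show ?case
  proof (rule Ck_on_Suc_intro[OF assms(2)
          bounded_bilinear.FDERIV[OF assms(1) Ck_on_Suc_has_derivative[OF Suc.prems(1)]
            Ck_on_Suc_has_derivative[OF Suc.prems(2)]]])
    show "Ck_on n (\<lambda>x. b (f x) (frechet_derivative g (at x) v) +
            b (frechet_derivative f (at x) v) (g x)) U" for v
      using Suc.prems
      by (intro Ck_on_add[OF assms(2)] Suc.IH Ck_on_SucD[OF Suc.prems(1)] Ck_on_SucD[OF Suc.prems(2)])
        simp_all
  qed auto
qed

lemmas Ck_on_scaleR = Ck_on_bilinear[OF bounded_bilinear_scaleR]
lemmas Ck_on_mult = Ck_on_bilinear[OF bounded_bilinear_mult]

lemma Ck_on_linear_image:
  assumes "open U" "bounded_linear l" "Ck_on n f U"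
  shows "Ck_on n (\<lambda>x. l (f x)) U"
  using assms(3)
proof (induction n arbitrary: f)
  case 0
  then show ?case using bounded_linear.continuous_on[OF assms(2)] by auto
next
  case (Suc n)
  show ?case
    by (rule Ck_on_Suc_intro[OF assms(1) bounded_linear.has_derivative[OF assms(2)
          Ck_on_Suc_has_derivative[OF Suc.prems]]])
       (use Suc in auto)
qed

lemma Ck_on_inverse:
  fixes f :: "'a::real_normed_vector \<Rightarrow> real"
  assumes "open U" "\<And>x. x \<in> U \<Longrightarrow> f x \<noteq> 0" "Ck_on n f U"
  shows "Ck_on n (\<lambda>x. inverse (f x)) U"
  using assms(3)
proof (induction n)
  case 0
  then show ?case using assms(2) by (auto intro: continuous_on_inverse)
next
  case (Suc n)
  have inv: "Ck_on n (\<lambda>x. inverse (f x)) U"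
    using Suc.IH Ck_on_SucD[OF Suc.prems] by blast
  show ?case
  proof (rule Ck_on_Suc_intro[OF assms(1)])
    fix x assume "x \<in> U"
    then show "((\<lambda>x. inverse (f x)) has_derivative
        (\<lambda>v. (- 1) * ((inverse (f x) * frechet_derivative f (at x) v) * inverse (f x)))) (at x)"
      using Deriv.has_derivative_inverse[OF assms(2) Ck_on_Suc_has_derivative[OF Suc.prems], of x] by simp
  next
    show "Ck_on n (\<lambda>x. (- 1) * ((inverse (f x) * frechet_derivative f (at x) v) * inverse (f x))) U" for v
      using Suc.prems by (intro Ck_on_mult inv Ck_on_const assms(1)) simp
  qed
qed

text \<open>The derivative of a composition is \<open>\<Sum>b. (Dg(x)v \<bullet> b) Df(g(x))b\<close>, built by products from
  functions of one class lower; this is why the domain of \<open>f\<close> is Euclidean.\<close>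

lemma Ck_on_compose:
  fixes f :: "'b::euclidean_space \<Rightarrow> 'c::real_normed_vector"
    and g :: "'a::real_normed_vector \<Rightarrow> 'b"
  assumes "open U" "open V" "\<And>x. x \<in> U \<Longrightarrow> g x \<in> V" "Ck_on n f V" "Ck_on n g U"
  shows "Ck_on n (\<lambda>x. f (g x)) U"
  using assms(4,5)
proof (induction n arbitrary: f)
  case 0
  then show ?case using assms(3) by (auto intro!: continuous_on_compose2[of V f U g])
next
  case (Suc n)
  have lin: "frechet_derivative f (at (g x)) w =
      (\<Sum>b\<in>Basis. (w \<bullet> b) *\<^sub>R frechet_derivative f (at (g x)) b)" if "x \<in> U" for x w
  proof -
    have "linear (frechet_derivative f (at (g x)))"
      using Suc.prems(1) assms(3)[OF that] by (intro linear_frechet_derivative) simp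
    then have "frechet_derivative f (at (g x)) (\<Sum>b\<in>Basis. (w \<bullet> b) *\<^sub>R b) =
      (\<Sum>b\<in>Basis. (w \<bullet> b) *\<^sub>R frechet_derivative f (at (g x)) b)"
      by (simp add: linear_sum linear_scale)
    then show ?thesis by (simp add: euclidean_representation)
  qed
  show ?case
  proof (rule Ck_on_Suc_intro[OF assms(1)])
    fix x assume x: "x \<in> U"
    have "((\<lambda>x. f (g x)) has_derivative
        (\<lambda>v. frechet_derivative f (at (g x)) (frechet_derivative g (at x) v))) (at x)"
      by (rule has_derivative_compose[OF Ck_on_Suc_has_derivative[OF Suc.prems(2) x]
            Ck_on_Suc_has_derivative[OF Suc.prems(1) assms(3)[OF x]]])
    then show "((\<lambda>x. f (g x)) has_derivative
        (\<lambda>v. \<Sum>b\<in>Basis. (frechet_derivative g (at x) v \<bullet> b) *\<^sub>R frechet_derivative f (at (g x)) b)) (at x)"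
      by (subst (asm) lin[OF x])
  next
    show "Ck_on n (\<lambda>x. \<Sum>b\<in>Basis. (frechet_derivative g (at x) v \<bullet> b) *\<^sub>R
        frechet_derivative f (at (g x)) b) U" for v
      using Suc.prems(1,2)
      by (intro Ck_on_sum Ck_on_scaleR assms(1) Suc.IH Ck_on_SucD[OF Suc.prems(2)]
          Ck_on_linear_image[OF _ bounded_linear_inner_left]) simp_all
  qed
qed

lemma smooth_onD: "smooth_on f U \<Longrightarrow> Ck_on n f U"
  by (simp add: smooth_on_def)

lemma smooth_onI: "(\<And>n. Ck_on n f U) \<Longrightarrow> smooth_on f U"
  by (simp add: smooth_on_def)

lemma smooth_on_has_derivative:
  assumes "smooth_on f U" "x \<in> U"
  shows "(f has_derivative frechet_derivative f (at x)) (at x)"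
  using smooth_onD[OF assms(1)] assms(2) by (rule Ck_on_Suc_has_derivative)

lemma smooth_on_derivative:
  assumes "smooth_on f U"
  shows "smooth_on (\<lambda>x. frechet_derivative f (at x) v) U"
proof (rule smooth_onI)
  show "Ck_on n (\<lambda>x. frechet_derivative f (at x) v) U" for n
    using smooth_onD[OF assms, of "Suc n"] by simp
qed

lemma smooth_on_continuous: "smooth_on f U \<Longrightarrow> continuous_on U f"
  using smooth_onD[of f U 0] by simp

lemma smooth_on_subset: "smooth_on f U \<Longrightarrow> V \<subseteq> U \<Longrightarrow> smooth_on f V"
  by (intro smooth_onI) (rule Ck_on_subset[OF smooth_onD])

lemma smooth_on_cong:
  assumes "open U" "\<And>x. x \<in> U \<Longrightarrow> f x = g x" "smooth_on f U"
  shows "smooth_on g U"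
  by (rule smooth_onI) (rule Ck_on_cong[OF assms(1,2) smooth_onD[OF assms(3)]])

lemma smooth_on_id: "open U \<Longrightarrow> smooth_on (\<lambda>x. x) U"
  by (intro smooth_onI Ck_on_bounded_linear bounded_linear_ident)

section \<open>Tangent spaces of submanifolds and dimensions of orbits\<close>

lemma diffeo_on_derivatives:
  assumes "diffeo_on W \<phi>" "p \<in> W"
  shows diffeo_on_has_derivative: "(\<phi> has_derivative frechet_derivative \<phi> (at p)) (at p)"
    and diffeo_on_inv_has_derivative:
      "(inv_into W \<phi> has_derivative frechet_derivative (inv_into W \<phi>) (at (\<phi> p))) (at (\<phi> p))"
    and diffeo_on_inv_derivative_left:
      "frechet_derivative (inv_into W \<phi>) (at (\<phi> p)) (frechet_derivative \<phi> (at p) v) = v"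
    and diffeo_on_inv_derivative_right:
      "frechet_derivative \<phi> (at p) (frechet_derivative (inv_into W \<phi>) (at (\<phi> p)) w) = w"
proof -
  let ?\<psi> = "inv_into W \<phi>"
  let ?D = "frechet_derivative \<phi> (at p)" and ?E = "frechet_derivative ?\<psi> (at (\<phi> p))"
  have W: "open W" "open (\<phi> ` W)" "inj_on \<phi> W" "smooth_on \<phi> W" "smooth_on ?\<psi> (\<phi> ` W)"
    using assms(1) by (auto simp: diffeo_on_def)
  show D: "(\<phi> has_derivative ?D) (at p)"
    by (rule smooth_on_has_derivative[OF W(4) assms(2)])
  show E: "(?\<psi> has_derivative ?E) (at (\<phi> p))"
    by (rule smooth_on_has_derivative[OF W(5)]) (use assms(2) in simp)
  have inv_p: "?\<psi> (\<phi> p) = p" using W(3) assms(2) by simp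
  have "((\<lambda>x. ?\<psi> (\<phi> x)) has_derivative (\<lambda>v. ?E (?D v))) (at p)"
    by (rule has_derivative_compose[OF D E])
  moreover have "((\<lambda>x. ?\<psi> (\<phi> x)) has_derivative (\<lambda>v. v)) (at p)"
    by (rule has_derivative_transform_within_open[OF has_derivative_ident W(1) assms(2)])
       (use W(3) in simp)
  ultimately have "(\<lambda>v. ?E (?D v)) = (\<lambda>v. v)" by (rule has_derivative_unique)
  then show "?E (?D v) = v" by (rule fun_cong)
  have "((\<lambda>y. \<phi> (?\<psi> y)) has_derivative (\<lambda>v. ?D (?E v))) (at (\<phi> p))"
    by (rule has_derivative_compose[OF E]) (simp add: inv_p D)
  moreover have "((\<lambda>y. \<phi> (?\<psi> y)) has_derivative (\<lambda>v. v)) (at (\<phi> p))"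
    by (rule has_derivative_transform_within_open[OF has_derivative_ident W(2)])
       (use assms(2) f_inv_into_f[of _ \<phi> W] in auto)
  ultimately have "(\<lambda>v. ?D (?E v)) = (\<lambda>v. v)" by (rule has_derivative_unique)
  then show "?D (?E w) = w" by (rule fun_cong)
qed

lemma diffeo_on_ident:
  assumes "open W" shows "diffeo_on W (\<lambda>x::'a::euclidean_space. x)"
  unfolding diffeo_on_def using assms
  by (auto intro: smooth_on_id smooth_on_cong[OF assms _ smooth_on_id[OF assms]]
      simp: inv_into_f_eq)

lemma submanifold_slice:
  fixes V :: "'a::euclidean_space set"
  assumes "open O1" "subspace V"
  shows "submanifold (dim V) (V \<inter> O1)"
  unfolding submanifold_def
proof
  fix p assume "p \<in> V \<inter> O1"
  then have "p \<in> O1 \<and> diffeo_on O1 (\<lambda>x. x) \<and> subspace V \<and> dim V = dim V \<and>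
      (\<lambda>x. x) ` (O1 \<inter> (V \<inter> O1)) = V \<inter> (\<lambda>x. x) ` O1"
    using assms diffeo_on_ident by auto
  then show "\<exists>W (\<Phi> :: 'a \<Rightarrow> 'a) V'. p \<in> W \<and> diffeo_on W \<Phi> \<and> subspace V' \<and> dim V' = dim V \<and>
       \<Phi> ` (W \<inter> (V \<inter> O1)) = V' \<inter> \<Phi> ` W"
    by - (rule exI[where x = O1], rule exI[where x = "\<lambda>x. x"], rule exI[where x = V])
qed

lemma derivative_in_closed_subspace:
  fixes c :: "real \<Rightarrow> 'a::euclidean_space"
  assumes "subspace V" "(c has_vector_derivative v) (at 0)" "\<forall>\<^sub>F t in at 0. c t \<in> V" "c 0 \<in> V"
  shows "v \<in> V"
proof (rule Lim_in_closed_set[OF closed_subspace[OF assms(1)]])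
  show "((\<lambda>t. inverse t *\<^sub>R (c t - c 0)) \<longlongrightarrow> v) (at 0)"
  proof -
    have "(\<lambda>t. norm (c (0 + t) - c 0 - t *\<^sub>R v) / norm t) \<midarrow>0\<rightarrow> 0"
      using assms(2) unfolding has_vector_derivative_def has_derivative_at by blast
    moreover have "\<forall>\<^sub>F t in at 0. norm (c (0 + t) - c 0 - t *\<^sub>R v) / norm t =
        norm (inverse t *\<^sub>R (c t - c 0) - v)"
      unfolding eventually_at_filter
    proof (rule always_eventually, intro allI impI)
      fix t :: real assume t: "t \<noteq> 0"
      then have "inverse t *\<^sub>R (c t - c 0) - v = inverse t *\<^sub>R (c t - c 0 - t *\<^sub>R v)"
        by (simp add: scaleR_diff_right)
      then show "norm (c (0 + t) - c 0 - t *\<^sub>R v) / norm t = norm (inverse t *\<^sub>R (c t - c 0) - v)"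
        by (simp add: divide_inverse mult.commute)
    qed
    ultimately have "(\<lambda>t. norm (inverse t *\<^sub>R (c t - c 0) - v)) \<midarrow>0\<rightarrow> 0"
      by (rule Lim_transform_eventually)
    then show ?thesis by (simp only: tendsto_norm_zero_iff Lim_null[symmetric])
  qed
  show "\<forall>\<^sub>F t in at 0. inverse t *\<^sub>R (c t - c 0) \<in> V"
    using assms(3) by eventually_elim (use assms(1,4) in \<open>auto intro: subspace_scale subspace_diff\<close>)
qed auto

text \<open>A slice chart \<open>\<Phi>\<close> carries curves in \<open>N\<close> to curves in a linear subspace, whose velocities
  stay in that subspace; hence the tangent space is its preimage under the invertible
  derivative of \<open>\<Phi>\<close>.\<close>

lemma tangent_space_submanifold:
  fixes N :: "'a::euclidean_space set"
  assumes "submanifold d N" "p \<in> N"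
  shows subspace_tangent_space: "subspace (tangent_space N p)"
    and dim_tangent_space: "dim (tangent_space N p) = d"
proof -
  obtain W and \<Phi> :: "'a \<Rightarrow> 'a" and V where W: "p \<in> W" "diffeo_on W \<Phi>" "subspace V" "dim V = d"
      "\<Phi> ` (W \<inter> N) = V \<inter> \<Phi> ` W"
    using assms unfolding submanifold_def by metis
  let ?\<Psi> = "inv_into W \<Phi>"
  let ?D = "frechet_derivative \<Phi> (at p)" and ?E = "frechet_derivative ?\<Psi> (at (\<Phi> p))"
  note D = diffeo_on_has_derivative[OF W(2,1)] and E = diffeo_on_inv_has_derivative[OF W(2,1)]
  note ED = diffeo_on_inv_derivative_left[OF W(2,1)]
    and DE = diffeo_on_inv_derivative_right[OF W(2,1)]
  have op: "open W" "open (\<Phi> ` W)" and inj: "inj_on \<Phi> W"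
    using W(2) by (auto simp: diffeo_on_def)
  have linE: "linear ?E" using E by (rule has_derivative_linear)
  have p: "\<Phi> p \<in> V" using W(1,5) assms(2) by blast
  have "tangent_space N p = ?E ` V"
  proof (intro equalityI subsetI)
    fix v assume "v \<in> tangent_space N p"
    then obtain c where c: "c 0 = p" "\<forall>\<^sub>F t in at (0::real). c t \<in> N"
        "(c has_vector_derivative v) (at 0)"
      by (auto simp: tangent_space_def)
    have "continuous (at 0) c"
      using c(3) by (rule has_vector_derivative_continuous)
    then have "\<forall>\<^sub>F t in at 0. c t \<in> W"
      unfolding continuous_at by (rule topological_tendstoD) (use op W(1) c(1) in auto)
    with c(2) have "\<forall>\<^sub>F t in at 0. \<Phi> (c t) \<in> V"
      by eventually_elim (use W(5) in blast)
    moreover have "((\<lambda>t. \<Phi> (c t)) has_vector_derivative ?D v) (at 0)"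
      using vector_derivative_diff_chain_within[of c v 0 UNIV \<Phi> ?D] c(1,3) D
      by (simp add: o_def has_derivative_at_withinI)
    moreover have "\<Phi> (c 0) \<in> V" using c(1) p by simp
    ultimately have "?D v \<in> V"
      using derivative_in_closed_subspace[OF W(3), of "\<lambda>t. \<Phi> (c t)"] by blast
    then show "v \<in> ?E ` V" using ED[of v] by (metis imageI)
  next
    fix v assume "v \<in> ?E ` V"
    then obtain u where u: "u \<in> V" "v = ?E u" by blast
    define c where "c t = ?\<Psi> (\<Phi> p + t *\<^sub>R u)" for t :: real
    have line: "((\<lambda>t. \<Phi> p + t *\<^sub>R u) has_vector_derivative u) (at 0)"
      by (auto intro!: derivative_eq_intros)
    have "((\<lambda>t. \<Phi> p + t *\<^sub>R u) \<longlongrightarrow> \<Phi> p) (at (0::real))"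
      by (auto intro!: tendsto_eq_intros)
    then have "\<forall>\<^sub>F t in at 0. \<Phi> p + t *\<^sub>R u \<in> \<Phi> ` W"
      by (rule topological_tendstoD) (use op W(1) in auto)
    then have "\<forall>\<^sub>F t in at 0. c t \<in> N"
    proof eventually_elim
      case (elim t)
      have "\<Phi> p + t *\<^sub>R u \<in> V" using p u(1) W(3) by (simp add: subspace_add subspace_scale)
      then have "\<Phi> p + t *\<^sub>R u \<in> \<Phi> ` (W \<inter> N)" using elim W(5) by blast
      then show ?case using inj by (auto simp: c_def)
    qed
    moreover have "c 0 = p" using inj W(1) by (simp add: c_def)
    moreover have "(c has_vector_derivative v) (at 0)"
      using vector_derivative_diff_chain_within[OF line, of ?\<Psi> ?E] E
      by (simp add: o_def has_derivative_at_withinI c_def[abs_def] u(2))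
    ultimately show "v \<in> tangent_space N p" by (auto simp: tangent_space_def)
  qed
  moreover have "inj_on ?E V" using DE by (metis inj_on_inverseI)
  ultimately show "subspace (tangent_space N p)" "dim (tangent_space N p) = d"
    using linE W(3,4) dim_image_eq[OF linE] by (auto simp: linear_subspace_image span_eq_iff[THEN iffD2])
qed

lemma tangent_space_slice:
  fixes V :: "'a::euclidean_space set"
  assumes "open O1" "subspace V" "p \<in> V \<inter> O1"
  shows "tangent_space (V \<inter> O1) p = V"
proof (rule sym, rule subspace_dim_equal[OF assms(2)])
  note sub = submanifold_slice[OF assms(1,2)]
  show "subspace (tangent_space (V \<inter> O1) p)"
    by (rule subspace_tangent_space[OF sub assms(3)])
  show "dim (tangent_space (V \<inter> O1) p) \<le> dim V"
    by (simp add: dim_tangent_space[OF sub assms(3)])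
  show "V \<subseteq> tangent_space (V \<inter> O1) p"
  proof
    fix v assume v: "v \<in> V"
    have "((\<lambda>t. p + t *\<^sub>R v) \<longlongrightarrow> p) (at (0::real))"
      by (auto intro!: tendsto_eq_intros)
    then have "\<forall>\<^sub>F t in at (0::real). p + t *\<^sub>R v \<in> O1"
      by (rule topological_tendstoD) (use assms in auto)
    then have "\<forall>\<^sub>F t in at (0::real). p + t *\<^sub>R v \<in> V \<inter> O1"
      by eventually_elim (use assms v in \<open>auto simp: subspace_add subspace_scale\<close>)
    moreover have "((\<lambda>t. p + t *\<^sub>R v) has_vector_derivative v) (at 0)"
      by (auto intro!: derivative_eq_intros)
    ultimately show "v \<in> tangent_space (V \<inter> O1) p"
      unfolding tangent_space_def by (intro CollectI exI[of _ "\<lambda>t. p + t *\<^sub>R v"]) auto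
  qed
qed

text \<open>An orbit has the values of the fields as its tangent spaces, so its dimension can be read off
  from the values at the point alone; in particular it does not depend on the chosen orbit piece.\<close>

lemma dim_values_orbit:
  assumes "orbit_has_dim M L p d"
  shows "subspace ((\<lambda>X. X p) ` L)" "dim ((\<lambda>X. X p) ` L) = d"
proof -
  obtain N where N: "p \<in> N" "submanifold d N" "tangent_space N p = (\<lambda>X. X p) ` L"
    using assms unfolding orbit_has_dim_def local_orbit_def by blast
  show "subspace ((\<lambda>X. X p) ` L)" "dim ((\<lambda>X. X p) ` L) = d"
    using subspace_tangent_space[OF N(2,1)] dim_tangent_space[OF N(2,1)] N(3) by simp_all
qed

text \<open>If the values of the fields along a linear slice are constantly equal to the slice
  direction, then the slice is an orbit; it is made connected by shrinking it to a ball.\<close>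

lemma orbit_has_dim_slice:
  fixes V :: "'a::euclidean_space set"
  assumes "open O1" "O1 \<subseteq> M" "subspace V" "p \<in> V \<inter> O1"
    and vals: "\<And>q. q \<in> V \<inter> O1 \<Longrightarrow> (\<lambda>X. X q) ` L = V"
  shows "orbit_has_dim M L p (dim V)"
proof -
  obtain r where r: "r > 0" "ball p r \<subseteq> O1"
    using assms(1,4) open_contains_ball by blast
  have "local_orbit M L (dim V) (V \<inter> ball p r)"
    unfolding local_orbit_def
  proof (intro conjI ballI)
    show "V \<inter> ball p r \<subseteq> M" using r assms(2) by blast
    show "connected (V \<inter> ball p r)"
      by (intro convex_connected convex_Int subspace_imp_convex assms(3) convex_ball)
    show "submanifold (dim V) (V \<inter> ball p r)"
      by (rule submanifold_slice[OF open_ball assms(3)])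
    show "tangent_space (V \<inter> ball p r) q = (\<lambda>X. X q) ` L" if "q \<in> V \<inter> ball p r" for q
    proof -
      have "q \<in> V \<inter> O1" using that r by blast
      then show ?thesis using tangent_space_slice[OF open_ball assms(3) that] vals[of q] by simp
    qed
  qed
  moreover have "p \<in> V \<inter> ball p r" using assms(4) r by simp
  ultimately show ?thesis unfolding orbit_has_dim_def by blast
qed

text \<open>Two \<open>d\<close>-dimensional submanifolds, one inside the other: by invariance of domain the
  smaller one is relatively open in the larger, here a linear subspace.\<close>

lemma submanifold_openin_subspace:
  fixes V :: "'a::euclidean_space set"
  assumes "submanifold (dim V) H" "subspace V" "H \<subseteq> V"
  shows "openin (top_of_set V) H"
proof (subst openin_subopen, intro ballI)
  fix p assume p: "p \<in> H"
  obtain W and \<Phi> :: "'a \<Rightarrow> 'a" and V' where W: "p \<in> W" "diffeo_on W \<Phi>" "subspace V'"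
      "dim V' = dim V" "\<Phi> ` (W \<inter> H) = V' \<inter> \<Phi> ` W"
    using assms(1) p unfolding submanifold_def by metis
  let ?\<Psi> = "inv_into W \<Phi>"
  have op: "open (\<Phi> ` W)" "inj_on \<Phi> W" "smooth_on ?\<Psi> (\<Phi> ` W)"
    using W(2) by (auto simp: diffeo_on_def)
  have img: "?\<Psi> ` (V' \<inter> \<Phi> ` W) = W \<inter> H"
    unfolding W(5)[symmetric] using op(2) by (simp add: inv_into_image_cancel)
  have "openin (top_of_set V) (?\<Psi> ` (V' \<inter> \<Phi> ` W))"
  proof (rule invariance_of_domain_subspaces[OF _ W(3) assms(2)])
    show "openin (top_of_set V') (V' \<inter> \<Phi> ` W)" using op(1) by (simp add: openin_open_Int)
    show "continuous_on (V' \<inter> \<Phi> ` W) ?\<Psi>"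
      by (rule continuous_on_subset[OF smooth_on_continuous[OF op(3)]]) auto
    show "?\<Psi> \<in> V' \<inter> \<Phi> ` W \<rightarrow> V" using img assms(3) by blast
    show "inj_on ?\<Psi> (V' \<inter> \<Phi> ` W)" by (rule inj_on_inv_into) auto
  qed (simp add: W(4))
  then have "openin (top_of_set V) (W \<inter> H)" by (simp only: img)
  then show "\<exists>T. openin (top_of_set V) T \<and> p \<in> T \<and> T \<subseteq> H"
    using p W(1) by blast
qed

section \<open>Straightening a commuting frame\<close>

text \<open>The primitive is the integral of \<open>P dx + Q dy\<close> along the bottom edge and then upwards. Its
  \<open>y\<close>-derivative is \<open>Q\<close> at once; closedness turns the \<open>x\<close>-derivative of the second integral into
  \<open>P (x, y) - P (x, c)\<close>. The closed box with base point at its lower corner keeps the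
  integration bounds ordered.\<close>

lemma closed_form_has_primitive_on_box:
  fixes P Q :: "plane \<Rightarrow> 'b::banach"
  assumes P: "\<And>p. p \<in> {a..b} \<times> {c..d} \<Longrightarrow> (P has_derivative P' p) (at p)"
    and Q: "\<And>p. p \<in> {a..b} \<times> {c..d} \<Longrightarrow> (Q has_derivative Q' p) (at p)"
    and closed: "\<And>p. p \<in> {a..b} \<times> {c..d} \<Longrightarrow> P' p (0, 1) = Q' p (1, 0)"
    and cont: "continuous_on ({a..b} \<times> {c..d}) (\<lambda>p. Q' p (1, 0))"
  shows "\<exists>f. \<forall>p \<in> {a<..<b} \<times> {c<..<d}.
    (f has_derivative (\<lambda>v. fst v *\<^sub>R P p + snd v *\<^sub>R Q p)) (at p)"
proof -
  define f where "f x y = integral {a..x} (\<lambda>s. P (s, c)) + integral {c..y} (\<lambda>t. Q (x, t))" for x y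
  have contP: "continuous_on ({a..b} \<times> {c..d}) P" and contQ: "continuous_on ({a..b} \<times> {c..d}) Q"
    using P Q by (auto intro!: continuous_at_imp_continuous_on has_derivative_continuous)
  have Pt: "((\<lambda>t. P (x, t)) has_vector_derivative P' (x, t) (0, 1)) (at t within S)"
    and Px: "((\<lambda>x. Q (x, t)) has_vector_derivative Q' (x, t) (1, 0)) (at x within S)"
    if "x \<in> {a..b}" "t \<in> {c..d}" for x t S
  proof -
    have "((\<lambda>t. (x, t)) has_vector_derivative (0, 1)) (at t within S)"
      by (auto intro!: derivative_eq_intros)
    from vector_derivative_diff_chain_within[OF this, of P "P' (x, t)"] P[of "(x, t)"] that
    show "((\<lambda>t. P (x, t)) has_vector_derivative P' (x, t) (0, 1)) (at t within S)"
      by (simp add: o_def has_derivative_at_withinI)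
    have "((\<lambda>x. (x, t)) has_vector_derivative (1, 0)) (at x within S)"
      by (auto intro!: derivative_eq_intros)
    from vector_derivative_diff_chain_within[OF this, of Q "Q' (x, t)"] Q[of "(x, t)"] that
    show "((\<lambda>x. Q (x, t)) has_vector_derivative Q' (x, t) (1, 0)) (at x within S)"
      by (simp add: o_def has_derivative_at_withinI)
  qed
  have fx: "((\<lambda>x. f x y) has_vector_derivative P (x, y)) (at x within {a..b})"
    if x: "x \<in> {a..b}" and y: "y \<in> {c..d}" for x y
  proof -
    have 1: "((\<lambda>x. integral {a..x} (\<lambda>s. P (s, c))) has_vector_derivative P (x, c)) (at x within {a..b})"
      by (rule integral_has_vector_derivative[OF _ x])
         (rule continuous_on_compose2[OF contP], use y in \<open>auto intro!: continuous_intros\<close>)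
    have "((\<lambda>x. integral (cbox c y) (\<lambda>t. Q (x, t))) has_vector_derivative
        integral (cbox c y) (\<lambda>t. Q' (x, t) (1, 0))) (at x within {a..b})"
    proof (rule leibniz_rule_vector_derivative)
      show "((\<lambda>x. Q (x, t)) has_vector_derivative Q' (x, t) (1, 0)) (at x within {a..b})"
        if "x \<in> {a..b}" "t \<in> cbox c y" for x t using Px that y by auto
      show "(\<lambda>t. Q (x, t)) integrable_on cbox c y" if "x \<in> {a..b}" for x
        by (rule integrable_continuous, rule continuous_on_compose2[OF contQ])
           (use that y in \<open>auto intro!: continuous_intros\<close>)
      show "continuous_on ({a..b} \<times> cbox c y) (\<lambda>(x, t). Q' (x, t) (1, 0))"
        by (rule continuous_on_eq[OF continuous_on_subset[OF cont]]) (use y in auto)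
    qed (use x in auto)
    moreover have "integral (cbox c y) (\<lambda>t. Q' (x, t) (1, 0)) = P (x, y) - P (x, c)"
    proof -
      have "((\<lambda>t. P' (x, t) (0, 1)) has_integral P (x, y) - P (x, c)) {c..y}"
        by (rule fundamental_theorem_of_calculus) (use x y in \<open>auto intro!: Pt\<close>)
      then have "((\<lambda>t. Q' (x, t) (1, 0)) has_integral P (x, y) - P (x, c)) {c..y}"
        by (rule has_integral_eq[rotated]) (use closed x y in auto)
      then show ?thesis by (simp add: integral_unique)
    qed
    ultimately show ?thesis
      using has_vector_derivative_add[OF 1] by (fastforce simp: f_def)
  qed
  have fy: "((\<lambda>y. f x y) has_vector_derivative Q (x, y)) (at y within {c..d})"
    if x: "x \<in> {a..b}" and y: "y \<in> {c..d}" for x y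
  proof -
    have "((\<lambda>y. integral {c..y} (\<lambda>t. Q (x, t))) has_vector_derivative Q (x, y)) (at y within {c..d})"
      by (rule integral_has_vector_derivative[OF _ y])
         (rule continuous_on_compose2[OF contQ], use x in \<open>auto intro!: continuous_intros\<close>)
    then show ?thesis
      using has_vector_derivative_add[OF has_vector_derivative_const[of "integral {a..x} (\<lambda>s. P (s, c))"]]
      by (fastforce simp: f_def)
  qed
  have "((\<lambda>(x, y). f x y) has_derivative (\<lambda>v. fst v *\<^sub>R P p + snd v *\<^sub>R Q p)) (at p)"
    if p: "p \<in> {a<..<b} \<times> {c<..<d}" for p
  proof -
    obtain x y where xy: "p = (x, y)" by (cases p)
    have xy': "x \<in> {a..b}" "y \<in> {c..d}" using p xy by auto
    have "((\<lambda>(x, y). f x y) has_derivative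
        (\<lambda>(tx, ty). tx *\<^sub>R P (x, y) + blinfun_apply (blinfun_scaleR_left (Q (x, y))) ty))
        (at (x, y) within {a..b} \<times> {c..d})"
    proof (rule has_derivative_partialsI)
      show "((\<lambda>x. f x y) has_derivative (\<lambda>h. h *\<^sub>R P (x, y))) (at x within {a..b})"
        using fx[OF xy'] by (simp add: has_vector_derivative_def)
      show "((\<lambda>y. f x y) has_derivative blinfun_apply (blinfun_scaleR_left (Q (x, y))))
          (at y within {c..d})" if "x \<in> {a..b}" "y \<in> {c..d}" for x y
        using fy[OF that] by (simp add: has_vector_derivative_def blinfun_scaleR_left.rep_eq)
      have "continuous_on ({a..b} \<times> {c..d}) (\<lambda>p. blinfun_scaleR_left (Q p))"
        by (rule bounded_linear.continuous_on[OF bounded_linear_blinfun_scaleR_left contQ])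
      then show "continuous (at (x, y) within {a..b} \<times> {c..d}) (\<lambda>(x, y). blinfun_scaleR_left (Q (x, y)))"
        using xy' by (simp add: continuous_on_eq_continuous_within split_def)
    qed (use xy' in auto)
    moreover have "at (x, y) within {a..b} \<times> {c..d} = at (x, y)"
    proof (rule at_within_open_subset[where S = "{a<..<b} \<times> {c<..<d}"])
      show "open ({a<..<b} \<times> {c<..<d})" by (intro open_Times) auto
      show "{a<..<b} \<times> {c<..<d} \<subseteq> {a..b} \<times> {c..d}" by auto
    qed (use p xy in auto)
    ultimately show ?thesis
      by (simp add: xy split_def blinfun_scaleR_left.rep_eq)
  qed
  then show ?thesis by blast
qed

lemma linear_plane_expand:
  fixes D :: "plane \<Rightarrow> 'b::real_vector"
  assumes "linear D"
  shows "D v = fst v *\<^sub>R D (1, 0) + snd v *\<^sub>R D (0, 1)"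
proof -
  have "D v = D (fst v *\<^sub>R (1, 0) + snd v *\<^sub>R (0, 1))" by (cases v) simp
  also have "\<dots> = fst v *\<^sub>R D (1, 0) + snd v *\<^sub>R D (0, 1)"
    by (simp only: linear_add[OF assms] linear_scale[OF assms])
  finally show ?thesis .
qed

definition plane_det :: "plane \<Rightarrow> plane \<Rightarrow> real"
  where "plane_det u w = fst u * snd w - snd u * fst w"

text \<open>Coordinates of \<open>v\<close> with respect to the basis \<open>u, w\<close>, by Cramer's rule.\<close>

definition coframe :: "plane \<Rightarrow> plane \<Rightarrow> plane \<Rightarrow> plane"
  where "coframe u w v = inverse (plane_det u w) *\<^sub>R (plane_det v w, plane_det u v)"

lemma coframe_frame:
  assumes "plane_det u w \<noteq> 0"
  shows coframe_first: "coframe u w u = (1, 0)"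
    and coframe_second: "coframe u w w = (0, 1)"
    and frame_coframe: "fst (coframe u w v) *\<^sub>R u + snd (coframe u w v) *\<^sub>R w = v"
    and coframe_combination: "coframe u w (fst v *\<^sub>R u + snd v *\<^sub>R w) = v"
proof -
  have d: "fst u * snd w - snd u * fst w \<noteq> 0" using assms by (simp add: plane_det_def)
  show "coframe u w u = (1, 0)" "coframe u w w = (0, 1)"
    using d by (auto simp: coframe_def plane_det_def)
  have i: "inverse (fst u * snd w - snd u * fst w) * (fst u * snd w - snd u * fst w) = 1"
    using d by simp
  show "fst (coframe u w v) *\<^sub>R u + snd (coframe u w v) *\<^sub>R w = v"
    unfolding prod_eq_iff using i
    by (auto simp: coframe_def plane_det_def) algebra+
  show "coframe u w (fst v *\<^sub>R u + snd v *\<^sub>R w) = v"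
    unfolding prod_eq_iff using i
    by (auto simp: coframe_def plane_det_def) algebra+
qed

lemma linear_coframe: "linear (coframe u w)"
  by (rule linearI) (auto simp: coframe_def plane_det_def algebra_simps)

lemma Ck_on_plane_det:
  assumes "open U" "Ck_on n f U" "Ck_on n g U"
  shows "Ck_on n (\<lambda>p. plane_det (f p) (g p)) U"
proof -
  have "Ck_on n (\<lambda>p. fst (f p) * snd (g p) + (- 1) * (snd (f p) * fst (g p))) U"
    by (intro Ck_on_add Ck_on_mult Ck_on_const Ck_on_linear_image[OF _ bounded_linear_fst]
        Ck_on_linear_image[OF _ bounded_linear_snd] assms)
  then show ?thesis by (simp add: plane_det_def)
qed

lemma Ck_on_coframe:
  assumes "open U" "Ck_on n E U" "Ck_on n F U" "\<And>p. p \<in> U \<Longrightarrow> plane_det (E p) (F p) \<noteq> 0"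
  shows "Ck_on n (\<lambda>p. coframe (E p) (F p) v) U"
proof -
  have "Ck_on n (\<lambda>p. inverse (plane_det (E p) (F p)) *\<^sub>R
      (plane_det v (F p) *\<^sub>R (1, 0) + plane_det (E p) v *\<^sub>R (0, 1)) :: plane) U"
    by (intro Ck_on_scaleR Ck_on_add Ck_on_inverse Ck_on_const Ck_on_plane_det assms)
  then show ?thesis unfolding coframe_def by simp
qed

text \<open>Differentiating \<open>\<theta>(E) = (1, 0)\<close> along \<open>F\<close> and \<open>\<theta>(F) = (0, 1)\<close> along \<open>E\<close> gives
  \<open>d\<theta>(E, F) = - \<theta>([E, F])\<close>, which vanishes; a two-form in the plane that vanishes on one
  frame is zero.\<close>

lemma coframe_closed:
  fixes E F :: "plane \<Rightarrow> plane"
  assumes U: "open U" "smooth_on E U" "smooth_on F U"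
    and det: "\<And>p. p \<in> U \<Longrightarrow> plane_det (E p) (F p) \<noteq> 0"
    and comm: "\<And>p. p \<in> U \<Longrightarrow>
      frechet_derivative F (at p) (E p) = frechet_derivative E (at p) (F p)"
    and p: "p \<in> U"
  shows "frechet_derivative (\<lambda>p. coframe (E p) (F p) (1, 0)) (at p) (0, 1) =
         frechet_derivative (\<lambda>p. coframe (E p) (F p) (0, 1)) (at p) (1, 0)"
proof -
  define \<theta> where "\<theta> p = coframe (E p) (F p)" for p
  define DP where "DP = frechet_derivative (\<lambda>p. \<theta> p (1, 0)) (at p)"
  define DQ where "DQ = frechet_derivative (\<lambda>p. \<theta> p (0, 1)) (at p)"
  have sm: "smooth_on (\<lambda>p. \<theta> p v) U" for v
    unfolding \<theta>_def
    by (rule smooth_onI) (rule Ck_on_coframe[OF U(1) smooth_onD[OF U(2)] smooth_onD[OF U(3)] det])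
  have DP: "((\<lambda>p. \<theta> p (1, 0)) has_derivative DP) (at p)"
    and DQ: "((\<lambda>p. \<theta> p (0, 1)) has_derivative DQ) (at p)"
    unfolding DP_def DQ_def by (rule smooth_on_has_derivative[OF sm p])+
  have lin: "linear (\<theta> q)" for q unfolding \<theta>_def by (rule linear_coframe)
  have exp: "\<theta> q v = fst v *\<^sub>R \<theta> q (1, 0) + snd v *\<^sub>R \<theta> q (0, 1)" for q v
    by (rule linear_plane_expand[OF lin])
  have dual: "fst (X p) *\<^sub>R DP v + snd (X p) *\<^sub>R DQ v = - \<theta> p (frechet_derivative X (at p) v)"
    if X: "smooth_on X U" and const: "\<And>q. q \<in> U \<Longrightarrow> \<theta> q (X q) = c" for X c v
  proof -
    let ?DX = "frechet_derivative X (at p)"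
    have DX: "(X has_derivative ?DX) (at p)" by (rule smooth_on_has_derivative[OF X p])
    have "((\<lambda>q. fst (X q) *\<^sub>R \<theta> q (1, 0) + snd (X q) *\<^sub>R \<theta> q (0, 1)) has_derivative
        (\<lambda>v. (fst (X p) *\<^sub>R DP v + fst (?DX v) *\<^sub>R \<theta> p (1, 0)) +
             (snd (X p) *\<^sub>R DQ v + snd (?DX v) *\<^sub>R \<theta> p (0, 1)))) (at p)"
      by (intro has_derivative_add has_derivative_scaleR has_derivative_fst has_derivative_snd DX DP DQ)
    moreover have "((\<lambda>q. fst (X q) *\<^sub>R \<theta> q (1, 0) + snd (X q) *\<^sub>R \<theta> q (0, 1)) has_derivative
        (\<lambda>v. 0)) (at p)"
      by (rule has_derivative_transform_within_open[OF has_derivative_const[of c] U(1) p])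
         (use const exp in metis)
    ultimately have "(\<lambda>v. (fst (X p) *\<^sub>R DP v + fst (?DX v) *\<^sub>R \<theta> p (1, 0)) +
             (snd (X p) *\<^sub>R DQ v + snd (?DX v) *\<^sub>R \<theta> p (0, 1))) = (\<lambda>v. 0)"
      by (rule has_derivative_unique)
    then have "(fst (X p) *\<^sub>R DP v + fst (?DX v) *\<^sub>R \<theta> p (1, 0)) +
             (snd (X p) *\<^sub>R DQ v + snd (?DX v) *\<^sub>R \<theta> p (0, 1)) = 0"
      by (rule fun_cong)
    moreover have "\<theta> p (?DX v) = fst (?DX v) *\<^sub>R \<theta> p (1, 0) + snd (?DX v) *\<^sub>R \<theta> p (0, 1)"
      by (rule exp)
    ultimately have "(fst (X p) *\<^sub>R DP v + snd (X p) *\<^sub>R DQ v) + \<theta> p (?DX v) = 0"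
      by (simp add: add_ac)
    then show ?thesis by (rule eq_neg_iff_add_eq_0[THEN iffD2])
  qed
  have "fst (E p) *\<^sub>R DP (F p) + snd (E p) *\<^sub>R DQ (F p) =
      fst (F p) *\<^sub>R DP (E p) + snd (F p) *\<^sub>R DQ (E p)"
  proof -
    have "fst (E p) *\<^sub>R DP (F p) + snd (E p) *\<^sub>R DQ (F p) = - \<theta> p (frechet_derivative E (at p) (F p))"
      by (rule dual[OF U(2)]) (simp add: \<theta>_def coframe_first det)
    also have "\<dots> = - \<theta> p (frechet_derivative F (at p) (E p))" by (simp add: comm[OF p])
    also have "\<dots> = fst (F p) *\<^sub>R DP (E p) + snd (F p) *\<^sub>R DQ (E p)"
      by (rule dual[OF U(3), symmetric]) (simp add: \<theta>_def coframe_second det)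
    finally show ?thesis .
  qed
  then have "plane_det (E p) (F p) *\<^sub>R DP (0, 1) = plane_det (E p) (F p) *\<^sub>R DQ (1, 0)"
    unfolding linear_plane_expand[OF has_derivative_linear[OF DP], of "E p"]
      linear_plane_expand[OF has_derivative_linear[OF DP], of "F p"]
      linear_plane_expand[OF has_derivative_linear[OF DQ], of "E p"]
      linear_plane_expand[OF has_derivative_linear[OF DQ], of "F p"]
    by (simp add: prod_eq_iff plane_det_def algebra_simps)
  then show ?thesis
    using det[OF p] unfolding DP_def DQ_def \<theta>_def by simp
qed

lemma plane_open_contains_box:
  fixes p :: plane
  assumes "open S" "p \<in> S"
  obtains a b c d where "p \<in> {a<..<b} \<times> {c<..<d}" "{a..b} \<times> {c..d} \<subseteq> S"
proof -
  obtain A B where AB: "open A" "open B" "p \<in> A \<times> B" "A \<times> B \<subseteq> S"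
    by (rule open_prod_elim[OF assms])
  have "fst p \<in> A" "snd p \<in> B" using AB(3) by (simp_all add: mem_Times_iff)
  obtain a b where ab: "cbox a b \<subseteq> A" "fst p \<in> box a b"
    by (rule open_contains_cbox[OF \<open>open A\<close> \<open>fst p \<in> A\<close>])
  obtain c d where cd: "cbox c d \<subseteq> B" "snd p \<in> box c d"
    by (rule open_contains_cbox[OF \<open>open B\<close> \<open>snd p \<in> B\<close>])
  show ?thesis
  proof (rule that)
    show "p \<in> {a<..<b} \<times> {c<..<d}" using ab(2) cd(2) by (simp add: mem_Times_iff)
    show "{a..b} \<times> {c..d} \<subseteq> S" using ab(1) cd(1) AB(4) by fastforce
  qed
qed

text \<open>The primitive of the dual coframe of the commuting frame maps \<open>E\<close> to \<open>\<partial>\<^sub>x\<close> and \<open>F\<close> to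
  \<open>\<partial>\<^sub>y\<close>. Its local inverse \<open>\<psi>\<close> solves \<open>D\<psi>(v) = v\<^sub>1 E(\<psi>) + v\<^sub>2 F(\<psi>)\<close>, so each class of
  differentiability of \<open>\<psi>\<close> yields the next one.\<close>

theorem canonical_coordinates_exist:
  fixes E F :: "plane \<Rightarrow> plane"
  assumes M: "open M" "smooth_on E M" "smooth_on F M"
    and comm: "\<And>p. p \<in> M \<Longrightarrow>
      frechet_derivative F (at p) (E p) = frechet_derivative E (at p) (F p)"
    and p0: "p0 \<in> M" "plane_det (E p0) (F p0) \<noteq> 0"
  shows "\<exists>W \<phi>. p0 \<in> W \<and> canonical_coordinates M E F W \<phi>"
proof -
  define S where "S = {p \<in> M. plane_det (E p) (F p) \<noteq> 0}"
  have "continuous_on M (\<lambda>p. plane_det (E p) (F p))"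
    using Ck_on_plane_det[OF M(1), of 0 E F] smooth_on_continuous[OF M(2)]
      smooth_on_continuous[OF M(3)] by simp
  then have "open (M \<inter> (\<lambda>p. plane_det (E p) (F p)) -` (- {0}))"
    by (rule continuous_open_preimage[OF _ M(1)]) auto
  then have S: "open S" by (simp add: S_def Int_def vimage_def)
  have SM: "S \<subseteq> M" and det: "\<And>p. p \<in> S \<Longrightarrow> plane_det (E p) (F p) \<noteq> 0" by (auto simp: S_def)
  note smE = smooth_on_subset[OF M(2) SM] and smF = smooth_on_subset[OF M(3) SM]
  define \<theta> where "\<theta> p = coframe (E p) (F p)" for p
  have sm\<theta>: "smooth_on (\<lambda>p. \<theta> p v) S" for v
    unfolding \<theta>_def
    by (rule smooth_onI) (rule Ck_on_coframe[OF S smooth_onD[OF smE] smooth_onD[OF smF] det])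
  have "p0 \<in> S" using p0 by (simp add: S_def)
  obtain a b c d where box: "p0 \<in> {a<..<b} \<times> {c<..<d}" "{a..b} \<times> {c..d} \<subseteq> S"
    by (rule plane_open_contains_box[OF S \<open>p0 \<in> S\<close>])
  define B where "B = {a<..<b} \<times> {c<..<d}"
  have B: "open B" "p0 \<in> B" unfolding B_def using box(1) by (auto intro: open_Times)
  have "B \<subseteq> {a..b} \<times> {c..d}" by (auto simp: B_def)
  then have BS: "B \<subseteq> S" using box(2) by blast
  have "\<exists>\<phi>. \<forall>p\<in>{a<..<b} \<times> {c<..<d}.
      (\<phi> has_derivative (\<lambda>v. fst v *\<^sub>R \<theta> p (1, 0) + snd v *\<^sub>R \<theta> p (0, 1))) (at p)"
  proof (rule closed_form_has_primitive_on_box)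
    show "((\<lambda>p. \<theta> p (1, 0)) has_derivative frechet_derivative (\<lambda>p. \<theta> p (1, 0)) (at p)) (at p)"
      if "p \<in> {a..b} \<times> {c..d}" for p
      by (rule smooth_on_has_derivative[OF sm\<theta>]) (use that box(2) in blast)
    show "((\<lambda>p. \<theta> p (0, 1)) has_derivative frechet_derivative (\<lambda>p. \<theta> p (0, 1)) (at p)) (at p)"
      if "p \<in> {a..b} \<times> {c..d}" for p
      by (rule smooth_on_has_derivative[OF sm\<theta>]) (use that box(2) in blast)
    show "frechet_derivative (\<lambda>p. \<theta> p (1, 0)) (at p) (0, 1) =
        frechet_derivative (\<lambda>p. \<theta> p (0, 1)) (at p) (1, 0)" if "p \<in> {a..b} \<times> {c..d}" for p
      unfolding \<theta>_def
      by (rule coframe_closed[OF S smE smF det comm]) (use that box(2) SM in auto)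
    show "continuous_on ({a..b} \<times> {c..d}) (\<lambda>p. frechet_derivative (\<lambda>p. \<theta> p (0, 1)) (at p) (1, 0))"
      by (rule continuous_on_subset[OF smooth_on_continuous[OF smooth_on_derivative[OF sm\<theta>]] box(2)])
  qed
  then obtain \<phi> where \<phi>: "\<And>p. p \<in> B \<Longrightarrow>
      (\<phi> has_derivative (\<lambda>v. fst v *\<^sub>R \<theta> p (1, 0) + snd v *\<^sub>R \<theta> p (0, 1))) (at p)"
    unfolding B_def by blast
  have lin: "linear (\<theta> p)" for p unfolding \<theta>_def by (rule linear_coframe)
  have "(\<lambda>v. fst v *\<^sub>R \<theta> p (1, 0) + snd v *\<^sub>R \<theta> p (0, 1)) = \<theta> p" for p
    by (rule ext) (rule linear_plane_expand[OF lin, symmetric])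
  with \<phi> have der: "(\<phi> has_derivative \<theta> p) (at p)" if "p \<in> B" for p
    using that by simp
  define \<Theta> where "\<Theta> p = Blinfun (\<theta> p)" for p
  have \<Theta>: "blinfun_apply (\<Theta> p) = \<theta> p" for p
    unfolding \<Theta>_def using lin by (simp add: bounded_linear_Blinfun_apply linear_conv_bounded_linear)
  define inv\<Theta> where "inv\<Theta> = Blinfun (\<lambda>v. fst v *\<^sub>R E p0 + snd v *\<^sub>R F p0)"
  have "linear (\<lambda>v. fst v *\<^sub>R E p0 + snd v *\<^sub>R F p0)"
    by (rule linearI) (auto simp: algebra_simps)
  then have inv\<Theta>: "blinfun_apply inv\<Theta> v = fst v *\<^sub>R E p0 + snd v *\<^sub>R F p0" for v
    unfolding inv\<Theta>_def by (simp add: bounded_linear_Blinfun_apply linear_conv_bounded_linear)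
  obtain U V \<psi> \<psi>' where U: "open U" "U \<subseteq> B" "p0 \<in> U" "open V" "homeomorphism U V \<phi> \<psi>"
    and \<psi>': "\<And>y. y \<in> V \<Longrightarrow> (\<psi> has_derivative \<psi>' y) (at y)"
      "\<And>y. y \<in> V \<Longrightarrow> \<psi>' y = inv (blinfun_apply (\<Theta> (\<psi> y)))"
  proof (rule inverse_function_theorem[OF B(1) _ _ B(2), of \<phi> \<Theta> inv\<Theta>])
    show "(\<phi> has_derivative blinfun_apply (\<Theta> p)) (at p)" if "p \<in> B" for p
      by (simp only: \<Theta> der that)
    show "continuous_on B \<Theta>"
      by (rule continuous_on_blinfun_componentwise)
         (simp add: \<Theta> continuous_on_subset[OF smooth_on_continuous[OF sm\<theta>] BS])
    show "inv\<Theta> o\<^sub>L \<Theta> p0 = id_blinfun"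
      by (rule blinfun_eqI) (simp add: inv\<Theta> \<Theta> \<theta>_def frame_coframe[OF p0(2)])
  qed blast
  obtain r where r: "r > 0" "ball p0 r \<subseteq> U"
    using U(1,3) open_contains_ball by blast
  define W where "W = ball p0 r"
  have W: "open W" "connected W" "p0 \<in> W" "W \<subseteq> U" "W \<subseteq> B" "W \<subseteq> S"
    using r U(2) BS by (auto simp: W_def)
  have \<psi>\<phi>: "\<psi> (\<phi> p) = p" if "p \<in> W" for p
    using U(5) W(4) that by (auto simp: homeomorphism_def)
  have inj: "inj_on \<phi> W" by (rule inj_on_inverseI[where g = \<psi>]) (rule \<psi>\<phi>)
  have inv_\<phi>: "inv_into W \<phi> (\<phi> p) = p" if "p \<in> W" for p
    using inj that by simp
  have img: "\<phi> ` W \<subseteq> V" using U(5) W(4) by (auto simp: homeomorphism_def)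
  have "\<phi> ` W = V \<inter> \<psi> -` W"
    using U(5) W(4) \<psi>\<phi> by (force simp: homeomorphism_def)
  moreover have "continuous_on V \<psi>" using U(5) by (simp add: homeomorphism_def)
  ultimately have open_img: "open (\<phi> ` W)"
    using continuous_open_preimage[OF _ U(4) W(1)] by metis
  have smooth_\<phi>: "smooth_on \<phi> W"
  proof (rule smooth_onI)
    fix n
    have "Ck_on (Suc n) \<phi> W"
      by (rule Ck_on_Suc_intro[OF W(1) der])
         (use W(5) Ck_on_subset[OF smooth_onD[OF sm\<theta>] W(6)] in auto)
    then show "Ck_on n \<phi> W" by (rule Ck_on_SucD)
  qed
  have der\<psi>: "(\<psi> has_derivative (\<lambda>v. fst v *\<^sub>R E (\<psi> y) + snd v *\<^sub>R F (\<psi> y))) (at y)"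
    if y: "y \<in> \<phi> ` W" for y
  proof -
    have "\<psi> y \<in> S" using y \<psi>\<phi> W(6) by auto
    then have d: "plane_det (E (\<psi> y)) (F (\<psi> y)) \<noteq> 0" by (rule det)
    have "inv (\<theta> (\<psi> y)) = (\<lambda>v. fst v *\<^sub>R E (\<psi> y) + snd v *\<^sub>R F (\<psi> y))"
      unfolding \<theta>_def
      by (rule inv_unique_comp) (auto simp: o_def frame_coframe[OF d] coframe_combination[OF d])
    then show ?thesis using \<psi>'[of y] y img by (auto simp: \<Theta>)
  qed
  have Ck_\<psi>: "Ck_on n \<psi> (\<phi> ` W)" for n
  proof (induction n)
    case 0
    then show ?case using \<open>continuous_on V \<psi>\<close> img by (simp add: continuous_on_subset)
  next
    case (Suc n)
    show ?case
    proof (rule Ck_on_Suc_intro[OF open_img der\<psi>])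
      show "Ck_on n (\<lambda>y. fst v *\<^sub>R E (\<psi> y) + snd v *\<^sub>R F (\<psi> y)) (\<phi> ` W)" for v
        by (intro Ck_on_add Ck_on_scaleR Ck_on_const open_img
            Ck_on_compose[OF open_img S _ smooth_onD[OF smE] Suc]
            Ck_on_compose[OF open_img S _ smooth_onD[OF smF] Suc])
           (use \<psi>\<phi> W(6) in auto)
    qed
  qed
  have "smooth_on (inv_into W \<phi>) (\<phi> ` W)"
    by (rule smooth_on_cong[OF open_img _ smooth_onI[OF Ck_\<psi>]]) (auto simp: \<psi>\<phi> inv_\<phi>)
  then have "diffeo_on W \<phi>"
    using W(1) open_img inj smooth_\<phi> by (simp add: diffeo_on_def)
  moreover have "push_field W \<phi> X = restrict0 (\<phi> ` W) (\<lambda>_. c)"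
    if "\<And>p. p \<in> S \<Longrightarrow> \<theta> p (X p) = c" for X c
  proof
    fix q
    show "push_field W \<phi> X q = restrict0 (\<phi> ` W) (\<lambda>_. c) q"
    proof (cases "q \<in> \<phi> ` W")
      case True
      then obtain p where p: "p \<in> W" "q = \<phi> p" by blast
      then have "p \<in> B" "p \<in> S" using W(5,6) by blast+
      then have "frechet_derivative \<phi> (at p) (X p) = c"
        by (simp only: frechet_derivative_eqI[OF der] that)
      then show ?thesis using p by (simp add: push_field_def restrict0_def inv_\<phi>)
    qed (simp add: push_field_def restrict0_def)
  qed
  then have "push_field W \<phi> E = restrict0 (\<phi> ` W) (\<lambda>_. (1, 0))"
    "push_field W \<phi> F = restrict0 (\<phi> ` W) (\<lambda>_. (0, 1))"
    using det by (auto simp: \<theta>_def coframe_first coframe_second)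
  ultimately have "canonical_coordinates M E F W \<phi>"
    using W(2,3,6) SM unfolding canonical_coordinates_def by auto
  with W(3) show ?thesis by blast
qed

section \<open>Brackets and push-forward\<close>

lemma lie_algebra_smooth:
  assumes "lie_algebra_of_fields M g" "X \<in> g"
  shows "smooth_on X M"
  using assms by (simp add: lie_algebra_of_fields_def)

lemma scaleR_fun_apply: "(c *\<^sub>R f) x = c *\<^sub>R f x"
  by (simp add: scaleR_fun_def)

lemma lie_bracket_at:
  "p \<in> M \<Longrightarrow> lie_bracket M X Y p =
    frechet_derivative Y (at p) (X p) - frechet_derivative X (at p) (Y p)"
  by (simp add: lie_bracket_def restrict0_def)

lemma lie_bracket_combination:
  assumes "lie_algebra_of_fields M g" "X \<in> g" "Y \<in> g" "Z \<in> g"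
  shows lie_bracket_combination_right: "lie_bracket M X (a *\<^sub>R Y + b *\<^sub>R Z) =
      a *\<^sub>R lie_bracket M X Y + b *\<^sub>R lie_bracket M X Z"
    and lie_bracket_combination_left: "lie_bracket M (a *\<^sub>R Y + b *\<^sub>R Z) X =
      a *\<^sub>R lie_bracket M Y X + b *\<^sub>R lie_bracket M Z X"
proof -
  have D: "frechet_derivative (a *\<^sub>R Y + b *\<^sub>R Z) (at p) =
      (\<lambda>v. a *\<^sub>R frechet_derivative Y (at p) v + b *\<^sub>R frechet_derivative Z (at p) v)"
    if "p \<in> M" for p
  proof (rule frechet_derivative_eqI)
    have "((\<lambda>p. a *\<^sub>R Y p + b *\<^sub>R Z p) has_derivative
       (\<lambda>v. a *\<^sub>R frechet_derivative Y (at p) v + b *\<^sub>R frechet_derivative Z (at p) v)) (at p)"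
      using that assms
      by (intro has_derivative_add has_derivative_scaleR_right smooth_on_has_derivative[of _ M]
          lie_algebra_smooth)
    then show "((a *\<^sub>R Y + b *\<^sub>R Z) has_derivative
       (\<lambda>v. a *\<^sub>R frechet_derivative Y (at p) v + b *\<^sub>R frechet_derivative Z (at p) v)) (at p)"
      by (simp add: scaleR_fun_def plus_fun_def)
  qed
  have lin: "linear (frechet_derivative X (at p))" if "p \<in> M" for p
    using smooth_on_has_derivative[OF lie_algebra_smooth[OF assms(1,2)] that]
    by (rule has_derivative_linear)
  show "lie_bracket M X (a *\<^sub>R Y + b *\<^sub>R Z) = a *\<^sub>R lie_bracket M X Y + b *\<^sub>R lie_bracket M X Z"
    by (rule ext) (simp add: lie_bracket_def restrict0_def D linear_add[OF lin] linear_scale[OF lin]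
        scaleR_fun_apply algebra_simps)
  show "lie_bracket M (a *\<^sub>R Y + b *\<^sub>R Z) X = a *\<^sub>R lie_bracket M Y X + b *\<^sub>R lie_bracket M Z X"
    by (rule ext) (simp add: lie_bracket_def restrict0_def D linear_add[OF lin] linear_scale[OF lin]
        scaleR_fun_apply algebra_simps)
qed

lemma lie_bracket_antisym: "lie_bracket M X Y = - lie_bracket M Y X"
  by (rule ext) (simp add: lie_bracket_def restrict0_def fun_Compl_def)

lemma push_field_at:
  assumes "diffeo_on W \<phi>" "p \<in> W"
  shows "push_field W \<phi> X (\<phi> p) = frechet_derivative \<phi> (at p) (X p)"
  using assms by (simp add: push_field_def restrict0_def diffeo_on_def)

lemma linear_push_field:
  assumes "diffeo_on W \<phi>"
  shows "linear (push_field W \<phi>)"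
proof (rule linearI; rule ext)
  have lin: "linear (frechet_derivative \<phi> (at (inv_into W \<phi> q)))" if "q \<in> \<phi> ` W" for q
    using diffeo_on_has_derivative[OF assms inv_into_into[OF that]] by (rule has_derivative_linear)
  show "push_field W \<phi> (X + Y) q = (push_field W \<phi> X + push_field W \<phi> Y) q" for X Y q
    by (simp add: push_field_def restrict0_def Let_def linear_add[OF lin])
  show "push_field W \<phi> (r *\<^sub>R X) q = (r *\<^sub>R push_field W \<phi> X) q" for r X q
    by (simp add: push_field_def restrict0_def Let_def scaleR_fun_apply linear_scale[OF lin])
qed

lemma canonical_coordinates_frame:
  assumes "canonical_coordinates M E F W \<phi>" "p \<in> W"
  shows "frechet_derivative \<phi> (at p) (E p) = (1, 0)" "frechet_derivative \<phi> (at p) (F p) = (0, 1)"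
proof -
  have d: "diffeo_on W \<phi>" and E: "push_field W \<phi> E = restrict0 (\<phi> ` W) (\<lambda>_. (1, 0))"
    and F: "push_field W \<phi> F = restrict0 (\<phi> ` W) (\<lambda>_. (0, 1))"
    using assms(1) by (auto simp: canonical_coordinates_def)
  show "frechet_derivative \<phi> (at p) (E p) = (1, 0)"
    using fun_cong[OF E, of "\<phi> p"] assms(2) by (simp add: push_field_at[OF d] restrict0_def)
  show "frechet_derivative \<phi> (at p) (F p) = (0, 1)"
    using fun_cong[OF F, of "\<phi> p"] assms(2) by (simp add: push_field_at[OF d] restrict0_def)
qed

text \<open>Naturality of the bracket would in general use the symmetry of the second derivative of
  \<open>\<phi>\<close>. In canonical coordinates of a commuting frame it follows from first derivatives: write
  the fields as combinations of \<open>E\<close> and \<open>F\<close>; the coefficients are the components of the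
  push-forwards, and all terms with derivatives of \<open>E\<close> and \<open>F\<close> cancel because \<open>[E, F] = 0\<close>.\<close>

lemma push_field_lie_bracket:
  assumes cc: "canonical_coordinates M E F W \<phi>"
    and sm: "smooth_on E M" "smooth_on F M" "smooth_on X M" "smooth_on Y M"
    and comm: "lie_bracket M E F = 0"
  shows push_field_differentiable: "q \<in> \<phi> ` W \<Longrightarrow> push_field W \<phi> X differentiable at q"
    and push_field_bracket: "push_field W \<phi> (lie_bracket M X Y) =
      lie_bracket (\<phi> ` W) (push_field W \<phi> X) (push_field W \<phi> Y)"
proof -
  have W: "W \<subseteq> M" "diffeo_on W \<phi>" using cc by (auto simp: canonical_coordinates_def)
  have op: "open W" "open (\<phi> ` W)" "inj_on \<phi> W" and sm\<phi>: "smooth_on \<phi> W"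
    using W(2) by (auto simp: diffeo_on_def)
  let ?\<psi> = "inv_into W \<phi>"
  define D where "D p = frechet_derivative \<phi> (at p)" for p
  have linD: "linear (D p)" if "p \<in> W" for p
    unfolding D_def using diffeo_on_has_derivative[OF W(2) that] by (rule has_derivative_linear)
  have injD: "v = w" if "p \<in> W" "D p v = D p w" for p v w
    using that diffeo_on_inv_derivative_left[OF W(2) that(1)] unfolding D_def by metis
  have DE: "D p (E p) = (1, 0)" and DF: "D p (F p) = (0, 1)" if "p \<in> W" for p
    unfolding D_def using canonical_coordinates_frame[OF cc that] by auto
  have D_comb: "D p (a *\<^sub>R E p + b *\<^sub>R F p) = (a, b)" if "p \<in> W" for p a b
    by (simp add: linear_add[OF linD[OF that]] linear_scale[OF linD[OF that]] DE[OF that] DF[OF that])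
  \<comment> \<open>The components of the push-forward of \<open>Z\<close>, as a function of the point of \<open>W\<close>, and their
    derivative.\<close>
  define C where "C Z p = D p (Z p)" for Z p
  define C' where "C' Z p = frechet_derivative (C Z) (at p)" for Z p
  have C': "(C Z has_derivative C' Z p) (at p)" if Z: "smooth_on Z M" and p: "p \<in> W" for Z p
  proof -
    have "((\<lambda>p. fst (Z p) *\<^sub>R D p (1, 0) + snd (Z p) *\<^sub>R D p (0, 1)) has_derivative
      (\<lambda>v. (fst (Z p) *\<^sub>R frechet_derivative (\<lambda>p. D p (1, 0)) (at p) v +
            fst (frechet_derivative Z (at p) v) *\<^sub>R D p (1, 0)) +
           (snd (Z p) *\<^sub>R frechet_derivative (\<lambda>p. D p (0, 1)) (at p) v +
            snd (frechet_derivative Z (at p) v) *\<^sub>R D p (0, 1)))) (at p)"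
      unfolding D_def
      by (intro has_derivative_add has_derivative_scaleR has_derivative_fst has_derivative_snd
          smooth_on_has_derivative[OF Z subsetD[OF W(1) p]]
          smooth_on_has_derivative[OF smooth_on_derivative[OF sm\<phi>] p])
    then obtain d where d: "((\<lambda>p. fst (Z p) *\<^sub>R D p (1, 0) + snd (Z p) *\<^sub>R D p (0, 1))
        has_derivative d) (at p)" by blast
    have "(C Z has_derivative d) (at p)"
      by (rule has_derivative_transform_within_open[OF d op(1) p])
         (simp add: C_def linear_plane_expand[OF linD, symmetric])
    then show ?thesis unfolding C'_def by (simp add: frechet_derivative_eqI)
  qed
  have rep: "Z p = fst (C Z p) *\<^sub>R E p + snd (C Z p) *\<^sub>R F p" if "p \<in> W" for Z p
    by (rule injD[OF that]) (simp add: D_comb[OF that] C_def)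
  have Z': "frechet_derivative Z (at p) v =
      (fst (C Z p) *\<^sub>R frechet_derivative E (at p) v + fst (C' Z p v) *\<^sub>R E p) +
      (snd (C Z p) *\<^sub>R frechet_derivative F (at p) v + snd (C' Z p v) *\<^sub>R F p)"
    if Z: "smooth_on Z M" and p: "p \<in> W" for Z p v
  proof -
    have pM: "p \<in> M" using p W(1) by blast
    have d: "((\<lambda>p. fst (C Z p) *\<^sub>R E p + snd (C Z p) *\<^sub>R F p) has_derivative
      (\<lambda>v. (fst (C Z p) *\<^sub>R frechet_derivative E (at p) v + fst (C' Z p v) *\<^sub>R E p) +
      (snd (C Z p) *\<^sub>R frechet_derivative F (at p) v + snd (C' Z p v) *\<^sub>R F p))) (at p)"
      by (intro has_derivative_add has_derivative_scaleR has_derivative_fst has_derivative_snd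
          smooth_on_has_derivative[OF sm(1) pM] smooth_on_has_derivative[OF sm(2) pM] C'[OF Z p])
    have "(Z has_derivative
      (\<lambda>v. (fst (C Z p) *\<^sub>R frechet_derivative E (at p) v + fst (C' Z p v) *\<^sub>R E p) +
      (snd (C Z p) *\<^sub>R frechet_derivative F (at p) v + snd (C' Z p v) *\<^sub>R F p))) (at p)"
      by (rule has_derivative_transform_within_open[OF d op(1) p]) (simp only: rep[symmetric])
    then show ?thesis by (simp add: frechet_derivative_eqI)
  qed
  have push: "(push_field W \<phi> Z has_derivative (\<lambda>v. C' Z p (frechet_derivative ?\<psi> (at (\<phi> p)) v)))
      (at (\<phi> p))" if Z: "smooth_on Z M" and p: "p \<in> W" for Z p
  proof -
    have inv: "?\<psi> (\<phi> p) = p" using op(3) p by simp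
    have d: "((\<lambda>q. C Z (?\<psi> q)) has_derivative (\<lambda>v. C' Z p (frechet_derivative ?\<psi> (at (\<phi> p)) v))) (at (\<phi> p))"
      by (rule has_derivative_compose[OF diffeo_on_inv_has_derivative[OF W(2) p]])
         (simp add: inv C'[OF Z p])
    show ?thesis
      by (rule has_derivative_transform_within_open[OF d op(2)])
         (use p in \<open>auto simp: C_def D_def push_field_def restrict0_def Let_def\<close>)
  qed
  show "push_field W \<phi> X differentiable at q" if "q \<in> \<phi> ` W" for q
    using push[OF sm(3)] that by (auto simp: differentiable_def)
  show "push_field W \<phi> (lie_bracket M X Y) =
      lie_bracket (\<phi> ` W) (push_field W \<phi> X) (push_field W \<phi> Y)"
  proof
    fix q
    show "push_field W \<phi> (lie_bracket M X Y) q =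
      lie_bracket (\<phi> ` W) (push_field W \<phi> X) (push_field W \<phi> Y) q"
    proof (cases "q \<in> \<phi> ` W")
      case True
      then obtain p where p: "p \<in> W" "q = \<phi> p" by blast
      have pM: "p \<in> M" using p W(1) by blast
      define E' where "E' = frechet_derivative E (at p)"
      define F' where "F' = frechet_derivative F (at p)"
      have linE': "linear E'" and linF': "linear F'"
        unfolding E'_def F'_def
        using smooth_on_has_derivative[OF sm(1) pM] smooth_on_has_derivative[OF sm(2) pM]
        by (auto intro: has_derivative_linear)
      have EF: "F' (E p) = E' (F p)"
        using fun_cong[OF comm, of p] pM by (simp add: lie_bracket_at E'_def F'_def)
      obtain a b where ab: "C X p = (a, b)" by fastforce
      obtain c d where cd: "C Y p = (c, d)" by fastforce
      have Xp: "X p = a *\<^sub>R E p + b *\<^sub>R F p" and Yp: "Y p = c *\<^sub>R E p + d *\<^sub>R F p"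
        using rep[OF p(1), of X] rep[OF p(1), of Y] ab cd by auto
      have "lie_bracket M X Y p =
         ((c *\<^sub>R E' (X p) + fst (C' Y p (X p)) *\<^sub>R E p) + (d *\<^sub>R F' (X p) + snd (C' Y p (X p)) *\<^sub>R F p)) -
         ((a *\<^sub>R E' (Y p) + fst (C' X p (Y p)) *\<^sub>R E p) + (b *\<^sub>R F' (Y p) + snd (C' X p (Y p)) *\<^sub>R F p))"
        using pM Z'[OF sm(3) p(1), of "Y p"] Z'[OF sm(4) p(1), of "X p"] ab cd
        by (simp add: lie_bracket_at E'_def F'_def)
      also have "c *\<^sub>R E' (X p) = (c * a) *\<^sub>R E' (E p) + (c * b) *\<^sub>R E' (F p)"
        by (simp add: Xp linear_add[OF linE'] linear_scale[OF linE'] scaleR_add_right)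
      also have "d *\<^sub>R F' (X p) = (d * a) *\<^sub>R E' (F p) + (d * b) *\<^sub>R F' (F p)"
        by (simp add: Xp linear_add[OF linF'] linear_scale[OF linF'] scaleR_add_right EF)
      also have "a *\<^sub>R E' (Y p) = (c * a) *\<^sub>R E' (E p) + (d * a) *\<^sub>R E' (F p)"
        by (simp add: Yp linear_add[OF linE'] linear_scale[OF linE'] scaleR_add_right mult.commute)
      also have "b *\<^sub>R F' (Y p) = (c * b) *\<^sub>R E' (F p) + (d * b) *\<^sub>R F' (F p)"
        by (simp add: Yp linear_add[OF linF'] linear_scale[OF linF'] scaleR_add_right EF mult.commute)
      finally have "lie_bracket M X Y p =
          (fst (C' Y p (X p)) - fst (C' X p (Y p))) *\<^sub>R E p +
          (snd (C' Y p (X p)) - snd (C' X p (Y p))) *\<^sub>R F p"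
        by (simp add: scaleR_diff_left)
      then have "D p (lie_bracket M X Y p) = C' Y p (X p) - C' X p (Y p)"
        by (simp only: D_comb[OF p(1)]) (simp add: prod_eq_iff)
      moreover have "frechet_derivative (push_field W \<phi> Z) (at q) (D p v) = C' Z p v"
        if "smooth_on Z M" for Z v
        unfolding p(2) frechet_derivative_eqI[OF push[OF that p(1)]] D_def
        by (simp add: diffeo_on_inv_derivative_left[OF W(2) p(1)])
      ultimately show ?thesis
        using True p sm(3,4) by (simp add: lie_bracket_at push_field_at[OF W(2) p(1)] D_def[symmetric])
    qed (simp add: push_field_def lie_bracket_def restrict0_def)
  qed
qed

section \<open>Normal form of the algebra\<close>

lemma solve_eigen_equation:
  fixes Y :: "plane \<Rightarrow> plane"
  assumes U: "open U" "connected U"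
    and Y: "\<And>q. q \<in> U \<Longrightarrow> Y differentiable at q"
    and x: "\<And>q. q \<in> U \<Longrightarrow> frechet_derivative Y (at q) (1, 0) = a *\<^sub>R Y q"
    and y: "\<And>q. q \<in> U \<Longrightarrow> frechet_derivative Y (at q) (0, 1) = 0"
  shows "\<exists>c. \<forall>q\<in>U. Y q = exp (a * fst q) *\<^sub>R c"
proof -
  have "((\<lambda>q. exp (- (a * fst q)) *\<^sub>R Y q) has_derivative (\<lambda>v. 0)) (at q)" if q: "q \<in> U" for q
  proof -
    have d: "(Y has_derivative frechet_derivative Y (at q)) (at q)"
      by (rule has_derivative_frechet[OF Y[OF q]])
    have "((\<lambda>q. exp (- (a * fst q)) *\<^sub>R Y q) has_derivative
        (\<lambda>v. exp (- (a * fst q)) *\<^sub>R frechet_derivative Y (at q) v +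
             (exp (- (a * fst q)) * - (a * fst v)) *\<^sub>R Y q)) (at q)"
      by (rule has_derivative_scaleR[OF _ d]) (auto intro!: derivative_eq_intros)
    moreover have "frechet_derivative Y (at q) v = (a * fst v) *\<^sub>R Y q" for v
      using linear_plane_expand[OF has_derivative_linear[OF d], of v] x[OF q] y[OF q]
      by (simp add: mult.commute)
    ultimately show ?thesis by simp
  qed
  then have const: "exp (- (a * fst p)) *\<^sub>R Y p = exp (- (a * fst q)) *\<^sub>R Y q"
    if "p \<in> U" "q \<in> U" for p q
    by (rule has_derivative_zero_unique_connected[OF U]) (use that in auto)
  show ?thesis
  proof (cases "U = {}")
    case False
    then obtain p where p: "p \<in> U" by blast
    have "Y q = exp (a * fst q) *\<^sub>R (exp (- (a * fst p)) *\<^sub>R Y p)" if "q \<in> U" for q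
      unfolding const[OF p that] by (simp add: exp_minus)
    then show ?thesis by blast
  qed simp
qed

lemma solve_affine_equation:
  fixes Y :: "plane \<Rightarrow> plane"
  assumes U: "open U" "connected U"
    and Y: "\<And>q. q \<in> U \<Longrightarrow> Y differentiable at q"
    and x: "\<And>q. q \<in> U \<Longrightarrow> frechet_derivative Y (at q) (1, 0) = 0"
    and y: "\<And>q. q \<in> U \<Longrightarrow> frechet_derivative Y (at q) (0, 1) = w"
  shows "\<exists>c. \<forall>q\<in>U. Y q = snd q *\<^sub>R w + c"
proof -
  have "((\<lambda>q. Y q - snd q *\<^sub>R w) has_derivative (\<lambda>v. 0)) (at q)" if q: "q \<in> U" for q
  proof -
    have d: "(Y has_derivative frechet_derivative Y (at q)) (at q)"
      by (rule has_derivative_frechet[OF Y[OF q]])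
    have "((\<lambda>q. Y q - snd q *\<^sub>R w) has_derivative
        (\<lambda>v. frechet_derivative Y (at q) v - snd v *\<^sub>R w)) (at q)"
      by (intro has_derivative_diff d has_derivative_scaleR_left has_derivative_snd has_derivative_ident)
    moreover have "frechet_derivative Y (at q) v = snd v *\<^sub>R w" for v
      using linear_plane_expand[OF has_derivative_linear[OF d], of v] x[OF q] y[OF q] by simp
    ultimately show ?thesis by simp
  qed
  then have const: "Y p - snd p *\<^sub>R w = Y q - snd q *\<^sub>R w" if "p \<in> U" "q \<in> U" for p q
    by (rule has_derivative_zero_unique_connected[OF U]) (use that in auto)
  show ?thesis
  proof (cases "U = {}")
    case False
    then obtain p where p: "p \<in> U" by blast
    have "Y q = snd q *\<^sub>R w + (Y p - snd p *\<^sub>R w)" if "q \<in> U" for q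
      unfolding const[OF p that] by simp
    then show ?thesis by blast
  qed simp
qed

lemma in_span_two: "x \<in> span {u, v} \<longleftrightarrow> (\<exists>a b. x = a *\<^sub>R u + b *\<^sub>R v)"
  by (simp add: span_breakdown_eq) (metis add.commute diff_add_cancel diff_diff_eq eq_iff_diff_eq_0)

lemma in_span_three: "x \<in> span {u, v, w} \<longleftrightarrow> (\<exists>a b c. x = a *\<^sub>R u + b *\<^sub>R v + c *\<^sub>R w)"
proof -
  have "x \<in> span {u, v, w} \<longleftrightarrow> (\<exists>a. x - a *\<^sub>R u \<in> span {v, w})"
    by (rule span_breakdown_eq)
  also have "\<dots> \<longleftrightarrow> (\<exists>a b c. x - a *\<^sub>R u = b *\<^sub>R v + c *\<^sub>R w)"
    by (simp only: in_span_two)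
  also have "\<dots> \<longleftrightarrow> (\<exists>a b c. x = a *\<^sub>R u + b *\<^sub>R v + c *\<^sub>R w)"
    by (simp add: algebra_simps)
  finally show ?thesis .
qed

text \<open>Only the subspace \<open>V\<close> has to be finite-dimensional; the space of all vector fields is not.\<close>

lemma span_eq_of_independent_card:
  fixes V :: "'v::real_vector set"
  assumes "subspace V" "S \<subseteq> V" "independent S" "finite S" "card S = dim V" "card S > 0"
  shows "V = span S"
proof
  obtain B where B: "B \<subseteq> V" "independent B" "V \<subseteq> span B" "card B = dim V"
    by (rule basis_exists)
  have "finite B" using B(4) assms(5,6) by (metis card_ge_0_finite)
  show "V \<subseteq> span S"
  proof (rule ccontr)
    assume "\<not> V \<subseteq> span S"
    then obtain x where x: "x \<in> V" "x \<notin> span S" by blast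
    have "independent (insert x S)" using x(2) assms(3) by (rule independent_insertI)
    moreover have "insert x S \<subseteq> span B" using x(1) assms(2) B(3) by blast
    ultimately have "card (insert x S) \<le> card B"
      using independent_span_bound[OF \<open>finite B\<close>] by blast
    moreover have "x \<notin> S" using x(2) span_base by blast
    ultimately show False using assms(4,5) B(4) by simp
  qed
  show "span S \<subseteq> V" by (rule span_minimal[OF assms(2,1)])
qed

locale planar_weight_algebra =
  fixes M :: "plane set"
    and g A :: "(plane \<Rightarrow> plane) set"
    and e1 e2 e3 e4 e5 :: "plane \<Rightarrow> plane"
    and k lam mu :: real
  assumes alg: "lie_algebra_of_fields M g" and dim5: "dim g = 5"
    and abelian_D: "abelian_fields M (derived_algebra M g)"
    and rank_D: "has_rank M (derived_algebra M g) 1"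
    and direct: "is_direct_sum g A (derived_algebra M g)" and abelian_A: "abelian_fields M A"
    and e1A: "e1 \<in> A" and e2A: "e2 \<in> A"
    and quot: "quotient_basis g (derived_algebra M g) e1 e2"
    and w3: "weight_vector M (derived_algebra M g) e1 e2 (0, k) e3"
    and w4: "weight_vector M (derived_algebra M g) e1 e2 (lam, k) e4"
    and w5: "weight_vector M (derived_algebra M g) e1 e2 (mu, k) e5"
    and nonzero: "k \<noteq> 0" "lam \<noteq> 0" "mu \<noteq> 0" "lam \<noteq> mu"
    and rank_Z: "has_rank M (span (insert e3 (centralizer M A e3))) 2"
begin

abbreviation D where "D \<equiv> derived_algebra M g"

lemma open_M: "open M" and subspace_g: "subspace g"
  using alg by (auto simp: lie_algebra_of_fields_def)

lemma bracket_g: "X \<in> g \<Longrightarrow> Y \<in> g \<Longrightarrow> lie_bracket M X Y \<in> g"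
  using alg by (auto simp: lie_algebra_of_fields_def)

lemma subspace_D: "subspace D"
  by (simp add: derived_algebra_def)

lemma D_subset: "D \<subseteq> g"
  unfolding derived_algebra_def by (rule span_minimal[OF _ subspace_g]) (auto intro: bracket_g)

lemma subspace_A: "subspace A" and A_Int_D: "A \<inter> D = {0}"
  using direct by (auto simp: is_direct_sum_def)

lemma A_subset: "A \<subseteq> g"
proof
  fix X assume "X \<in> A"
  then have "X + 0 \<in> g" using direct subspace_0[OF subspace_D] unfolding is_direct_sum_def by blast
  then show "X \<in> g" by simp
qed

lemma e_in_D: "e3 \<in> D" "e4 \<in> D" "e5 \<in> D"
  and e_nonzero: "e3 \<noteq> 0" "e4 \<noteq> 0" "e5 \<noteq> 0"
  and weights_e1: "lie_bracket M e1 e3 = 0" "lie_bracket M e1 e4 = lam *\<^sub>R e4"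
    "lie_bracket M e1 e5 = mu *\<^sub>R e5"
  and weights_e2: "lie_bracket M e2 e3 = k *\<^sub>R e3" "lie_bracket M e2 e4 = k *\<^sub>R e4"
    "lie_bracket M e2 e5 = k *\<^sub>R e5"
  using w3 w4 w5 by (auto simp: weight_vector_def)

lemma e_in_g: "e1 \<in> g" "e2 \<in> g" "e3 \<in> g" "e4 \<in> g" "e5 \<in> g"
  using A_subset D_subset e1A e2A e_in_D by auto

lemma smooth_g: "X \<in> g \<Longrightarrow> smooth_on X M"
  by (rule lie_algebra_smooth[OF alg])

lemma combination_in_D_imp_zero:
  assumes "a *\<^sub>R e1 + b *\<^sub>R e2 \<in> D" shows "a = 0" "b = 0"
proof -
  have "\<exists>!c :: real \<times> real. 0 - (fst c *\<^sub>R e1 + snd c *\<^sub>R e2) \<in> D"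
    using quot subspace_0[OF subspace_g] unfolding quotient_basis_def by blast
  moreover have "0 - (fst (0, 0) *\<^sub>R e1 + snd (0, 0) *\<^sub>R e2) \<in> D"
    using subspace_0[OF subspace_D] by simp
  moreover have "0 - (fst (a, b) *\<^sub>R e1 + snd (a, b) *\<^sub>R e2) \<in> D"
    using subspace_neg[OF subspace_D assms] by simp
  ultimately have "(a, b) = (0, 0)" by metis
  then show "a = 0" "b = 0" by auto
qed

text \<open>The weights of \<open>e1\<close> on \<open>e3, e4, e5\<close> are distinct, so these three are independent.\<close>

lemma weight_vectors_independent:
  "independent {e1, e2, e3, e4, e5}" "card {e1, e2, e3, e4, e5} = 5"
proof -
  have br: "lie_bracket M e1 (a *\<^sub>R e3 + b *\<^sub>R e4) = (b * lam) *\<^sub>R e4"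
    "lie_bracket M e1 (a *\<^sub>R e4 + b *\<^sub>R e3) = (a * lam) *\<^sub>R e4" for a b
    using lie_bracket_combination_right[OF alg e_in_g(1,3,4), of a b]
      lie_bracket_combination_right[OF alg e_in_g(1,4,3), of a b] weights_e1 by simp_all
  have i3: "e3 \<notin> span {}" using e_nonzero by simp
  have i4: "e4 \<notin> span {e3}"
  proof
    assume "e4 \<in> span {e3}"
    then obtain a where a: "e4 = a *\<^sub>R e3 + 0 *\<^sub>R e4" by (auto simp: span_singleton)
    have "lam *\<^sub>R e4 = 0" using br(1)[of a 0] weights_e1(2) a by simp
    then show False using nonzero e_nonzero by simp
  qed
  have i5: "e5 \<notin> span {e3, e4}"
  proof
    assume "e5 \<in> span {e3, e4}"
    then obtain a b where ab: "e5 = a *\<^sub>R e3 + b *\<^sub>R e4" by (auto simp: in_span_two)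
    have 1: "mu *\<^sub>R e5 = (b * lam) *\<^sub>R e4" using br(1)[of a b] weights_e1(3) ab by simp
    have 2: "lie_bracket M e1 (mu *\<^sub>R e5 + 0 *\<^sub>R e3) = (mu * mu) *\<^sub>R e5"
      using lie_bracket_combination_right[OF alg e_in_g(1,5,3), of mu 0] weights_e1 by simp
    have "(mu * mu) *\<^sub>R e5 = (b * lam * lam) *\<^sub>R e4"
      using br(2)[of "b * lam" 0] 2 1 by simp
    moreover have "(mu * mu) *\<^sub>R e5 = mu *\<^sub>R (b * lam) *\<^sub>R e4" using 1 by (metis scaleR_scaleR)
    ultimately have "(b * lam * lam) *\<^sub>R e4 = (mu * (b * lam)) *\<^sub>R e4"
      by (simp only: scaleR_scaleR)
    then have "b * lam * lam = mu * (b * lam)" using e_nonzero by (simp only: scaleR_cancel_right) simp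
    then have "b * lam * (lam - mu) = 0" by (simp add: algebra_simps)
    then have "b = 0" using nonzero by simp
    then show False using 1 nonzero e_nonzero by simp
  qed
  have sub: "span {e3, e4, e5} \<subseteq> D" by (rule span_minimal[OF _ subspace_D]) (use e_in_D in auto)
  have i2: "e2 \<notin> span {e3, e4, e5}"
    using sub combination_in_D_imp_zero(2)[of 0 1] by auto
  have i1: "e1 \<notin> span {e2, e3, e4, e5}"
  proof
    assume "e1 \<in> span {e2, e3, e4, e5}"
    then obtain b where "e1 - b *\<^sub>R e2 \<in> D" using sub by (auto simp: span_breakdown_eq[of _ e2])
    then show False using combination_in_D_imp_zero(1)[of 1 "- b"] by simp
  qed
  have flip: "{e3, e4, e5} = {e5, e4, e3}" "{e3, e4} = {e4, e3}" by auto
  show "independent {e1, e2, e3, e4, e5}"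
    unfolding flip(1) using i1 i2 i5 unfolding flip
    by (intro independent_insertI i3 i4 independent_empty)
  have "e1 \<notin> {e2, e3, e4, e5}" "e2 \<notin> {e3, e4, e5}" "e5 \<notin> {e3, e4}" "e4 \<notin> {e3}"
    using i1 i2 i4 i5 span_base by metis+
  then show "card {e1, e2, e3, e4, e5} = 5" by auto
qed

lemma g_eq_span: "g = span {e1, e2, e3, e4, e5}"
  by (rule span_eq_of_independent_card)
     (use e_in_g weight_vectors_independent dim5 subspace_g in auto)

lemma centralizer_subset: "centralizer M A e3 \<subseteq> span {e1}"
proof
  fix X assume "X \<in> centralizer M A e3"
  then have X: "X \<in> A" "lie_bracket M X e3 = 0" by (auto simp: centralizer_def)
  then have "X \<in> g" using A_subset by blast
  then obtain c :: "real \<times> real" where c: "X - (fst c *\<^sub>R e1 + snd c *\<^sub>R e2) \<in> D"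
    using quot unfolding quotient_basis_def by blast
  moreover have "X - (fst c *\<^sub>R e1 + snd c *\<^sub>R e2) \<in> A"
    by (intro subspace_diff subspace_add subspace_scale subspace_A X e1A e2A)
  ultimately have "X - (fst c *\<^sub>R e1 + snd c *\<^sub>R e2) = 0" using A_Int_D by blast
  then have Xc: "X = fst c *\<^sub>R e1 + snd c *\<^sub>R e2" by simp
  then have "(snd c * k) *\<^sub>R e3 = 0"
    using lie_bracket_combination_left[OF alg e_in_g(3,1,2), of "fst c" "snd c"] X(2)
      weights_e1(1) weights_e2(1) by simp
  then have "snd c = 0" using nonzero e_nonzero by simp
  then show "X \<in> span {e1}" using Xc by (auto simp: span_singleton)
qed

text \<open>Only multiples of \<open>e1\<close> centralize \<open>e3\<close> in \<open>A\<close>, so at a point with a two-dimensional orbit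
  already \<open>e1\<close> and \<open>e3\<close> have to span the plane.\<close>

lemma frame_where_rank_two:
  assumes "orbit_has_dim M (span (insert e3 (centralizer M A e3))) p 2"
  shows "plane_det (e1 p) (e3 p) \<noteq> 0"
proof
  assume det: "plane_det (e1 p) (e3 p) = 0"
  let ?L = "span (insert e3 (centralizer M A e3))"
  let ?V = "(\<lambda>X. X p) ` ?L"
  have "?V = UNIV"
  proof -
    have "subspace ?V" "dim ?V = 2" using dim_values_orbit[OF assms] by auto
    then show ?thesis by (metis DIM_prod DIM_real dim_UNIV one_add_one subspace_UNIV subspace_dim_equal
          order_refl subset_UNIV)
  qed
  moreover have "?L \<subseteq> span {e1, e3}"
    by (rule span_minimal[OF _ subspace_span])
       (use centralizer_subset span_mono[of "{e1}" "{e1, e3}"] in \<open>auto intro: span_base\<close>)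
  ultimately have "\<exists>a b. v = a *\<^sub>R e1 p + b *\<^sub>R e3 p" for v
  proof -
    have "v \<in> ?V" using \<open>?V = UNIV\<close> by blast
    then obtain X where "X \<in> ?L" "v = X p" by blast
    then show ?thesis using \<open>?L \<subseteq> span {e1, e3}\<close> by (force simp: in_span_two scaleR_fun_apply)
  qed
  then obtain a b c d where "(1, 0) = a *\<^sub>R e1 p + b *\<^sub>R e3 p" "(0, 1) = c *\<^sub>R e1 p + d *\<^sub>R e3 p"
    by metis
  then have "plane_det (1, 0) (0, 1) = (a * d - b * c) * plane_det (e1 p) (e3 p)"
    by (simp add: plane_det_def algebra_simps)
  then show False using det by (simp add: plane_det_def)
qed

lemma parallel_where_rank_one:
  assumes "orbit_has_dim M D p 1" "X \<in> D" "Y \<in> D"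
  shows "plane_det (X p) (Y p) = 0"
proof (rule ccontr)
  assume det: "plane_det (X p) (Y p) \<noteq> 0"
  let ?V = "(\<lambda>X. X p) ` D"
  have V: "subspace ?V" "dim ?V = 1" using dim_values_orbit[OF assms(1)] by auto
  have "v \<in> ?V" for v
  proof -
    have "fst (coframe (X p) (Y p) v) *\<^sub>R X p + snd (coframe (X p) (Y p) v) *\<^sub>R Y p \<in> ?V"
      by (intro subspace_add subspace_scale V) (use assms in auto)
    then show ?thesis by (simp add: frame_coframe[OF det])
  qed
  then have "?V = UNIV" by blast
  then show False using V(2) by simp
qed

lemma commuting_frame: "p \<in> M \<Longrightarrow>
    frechet_derivative e3 (at p) (e1 p) = frechet_derivative e1 (at p) (e3 p)"
  using fun_cong[OF weights_e1(1), of p] by (simp add: lie_bracket_at)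

lemma generic_canonical_coordinates:
  "generic_in M (\<lambda>p. \<exists>W \<phi>. p \<in> W \<and> canonical_coordinates M e1 e3 W \<phi>)"
proof -
  obtain G where G: "open G" "G \<subseteq> M" "M \<subseteq> closure G"
      "\<forall>p\<in>G. orbit_has_dim M (span (insert e3 (centralizer M A e3))) p 2"
    using rank_Z unfolding has_rank_def generic_in_def by blast
  have "\<exists>W \<phi>. p \<in> W \<and> canonical_coordinates M e1 e3 W \<phi>" if "p \<in> G" for p
    by (rule canonical_coordinates_exist[OF open_M])
       (use that G(2,4) e_in_g frame_where_rank_two[of p] in \<open>auto intro: smooth_g commuting_frame\<close>)
  then show ?thesis using G(1-3) unfolding generic_in_def by blast
qed

end

definition model_field :: "plane set \<Rightarrow> real \<Rightarrow> real \<Rightarrow> real \<Rightarrow> real \<Rightarrow> real \<Rightarrow> real \<Rightarrow> real \<Rightarrow> plane \<Rightarrow> plane"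
  where "model_field U lam mu a b c d m =
    restrict0 U (\<lambda>(x, y). (a, b * y + (c + d * exp (lam * x) + m * exp (mu * x))))"

definition model_algebra :: "plane set \<Rightarrow> real \<Rightarrow> real \<Rightarrow> (plane \<Rightarrow> plane) set"
  where "model_algebra U lam mu = {model_field U lam mu a b c d m | a b c d m. True}"

lemma is_direct_sum_model:
  assumes "open U" "U \<noteq> {}"
  shows "is_direct_sum (model_algebra U lam mu)
            (span {restrict0 U (\<lambda>(x, y). (1, 0)), restrict0 U (\<lambda>(x, y). (0, y))})
            (span {restrict0 U (\<lambda>(x, y). (0, 1)),
                   restrict0 U (\<lambda>(x, y). (0, exp (lam * x))),
                   restrict0 U (\<lambda>(x, y). (0, exp (mu * x)))})"
    (is "is_direct_sum _ (span {?X, ?Y}) (span {?C, ?D, ?M})")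
proof -
  have AB: "a *\<^sub>R ?X + b *\<^sub>R ?Y = model_field U lam mu a b 0 0 0" for a b
    by (rule ext) (auto simp: model_field_def restrict0_def scaleR_fun_apply)
  have CD: "c *\<^sub>R ?C + d *\<^sub>R ?D + m *\<^sub>R ?M = model_field U lam mu 0 0 c d m" for c d m
    by (rule ext) (auto simp: model_field_def restrict0_def scaleR_fun_apply)
  have sum: "model_field U lam mu a b 0 0 0 + model_field U lam mu 0 0 c d m =
      model_field U lam mu a b c d m" for a b c d m
    by (rule ext) (auto simp: model_field_def restrict0_def)
  have S1: "span {?X, ?Y} = {model_field U lam mu a b 0 0 0 | a b. True}"
    unfolding set_eq_iff mem_Collect_eq in_span_two AB by simp
  have S2: "span {?C, ?D, ?M} = {model_field U lam mu 0 0 c d m | c d m. True}"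
    unfolding set_eq_iff mem_Collect_eq in_span_three CD by simp
  have "Z = 0" if Z1: "Z = model_field U lam mu a b 0 0 0" and Z2: "Z = model_field U lam mu 0 0 c d m"
    for Z a b c d m
  proof -
    obtain p where p: "p \<in> U" using assms(2) by blast
    obtain x0 x1 y0 y1 where box: "p \<in> {x0<..<x1} \<times> {y0<..<y1}" "{x0..x1} \<times> {y0..y1} \<subseteq> U"
      by (rule plane_open_contains_box[OF assms(1) p])
    then have U: "(x0, y0) \<in> U" "(x0, y1) \<in> U" and y: "y0 < y1" by auto
    have eq: "model_field U lam mu a b 0 0 0 q = model_field U lam mu 0 0 c d m q" for q
      using Z1 Z2 by simp
    have "a = 0" using eq[of "(x0, y0)"] U by (simp add: model_field_def restrict0_def)
    moreover have "b * (y1 - y0) = 0"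
      using eq[of "(x0, y0)"] eq[of "(x0, y1)"] U
      by (simp add: model_field_def restrict0_def algebra_simps)
    ultimately show "Z = 0" using Z1 y by (auto simp: model_field_def restrict0_def fun_eq_iff zero_prod_def)
  qed
  then have "span {?X, ?Y} \<inter> span {?C, ?D, ?M} \<subseteq> {0}" unfolding S1 S2 by blast
  moreover have "0 \<in> span {?X, ?Y} \<inter> span {?C, ?D, ?M}" by (simp add: span_zero)
  moreover have "model_algebra U lam mu = {a + b |a b. a \<in> span {?X, ?Y} \<and> b \<in> span {?C, ?D, ?M}}"
    unfolding S1 S2 model_algebra_def by (auto simp: sum) (metis sum)+
  ultimately show ?thesis unfolding is_direct_sum_def by (simp add: subset_antisym)
qed

lemma frechet_derivative_restrict0_const:
  assumes "open U" "q \<in> U"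
  shows "frechet_derivative (restrict0 U (\<lambda>_. c)) (at q) v = 0"
proof -
  have "(restrict0 U (\<lambda>_. c) has_derivative (\<lambda>v. 0)) (at q)"
    by (rule has_derivative_transform_within_open[OF has_derivative_const[of c] assms])
       (simp add: restrict0_def)
  then show ?thesis by (simp add: frechet_derivative_eqI)
qed

text \<open>Replaces the pushed generators \<open>(c - k y) \<partial>\<^sub>y\<close>, \<open>c\<^sub>4 e\<^bsup>\<lambda>x\<^esup> \<partial>\<^sub>y\<close>, \<open>c\<^sub>5 e\<^bsup>\<mu>x\<^esup> \<partial>\<^sub>y\<close> by those of the model.\<close>

lemma span_rescaled:
  fixes x y c u v :: "'v::real_vector"
  assumes "k \<noteq> 0" "a \<noteq> 0" "b \<noteq> 0"
  shows "span {x, (- k) *\<^sub>R y + r *\<^sub>R c, c, a *\<^sub>R u, b *\<^sub>R v} = span ({x, y} \<union> {c, u, v})"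
    (is "span ?S = span ?T")
proof (rule antisym)
  have "(- k) *\<^sub>R y + r *\<^sub>R c \<in> span ?T" "a *\<^sub>R u \<in> span ?T" "b *\<^sub>R v \<in> span ?T"
    by (intro span_add span_scale span_base; simp)+
  then have "?S \<subseteq> span ?T" by (simp add: span_base)
  then show "span ?S \<subseteq> span ?T" by (rule span_minimal[OF _ subspace_span])
  have "(- inverse k) *\<^sub>R ((- k) *\<^sub>R y + r *\<^sub>R c) + (inverse k * r) *\<^sub>R c \<in> span ?S"
    by (intro span_add[of "(- inverse k) *\<^sub>R _"] span_scale span_base) simp_all
  moreover have "(- inverse k) *\<^sub>R ((- k) *\<^sub>R y + r *\<^sub>R c) + (inverse k * r) *\<^sub>R c = y"
    using assms(1) by (simp add: scaleR_add_right scaleR_diff_right)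
  moreover have "inverse a *\<^sub>R a *\<^sub>R u \<in> span ?S" "inverse b *\<^sub>R b *\<^sub>R v \<in> span ?S"
    by (intro span_scale span_base; simp)+
  ultimately have "?T \<subseteq> span ?S" using assms(2,3) by (simp add: span_base)
  then show "span ?T \<subseteq> span ?S" by (rule span_minimal[OF _ subspace_span])
qed

context planar_weight_algebra
begin

context
  fixes W :: "plane set" and \<phi> :: "plane \<Rightarrow> plane"
  assumes cc: "canonical_coordinates M e1 e3 W \<phi>"
begin

lemma W: "W \<noteq> {}" "W \<subseteq> M" "open W" "diffeo_on W \<phi>"
  using cc by (auto simp: canonical_coordinates_def diffeo_on_def)

lemma image: "open (\<phi> ` W)" "connected (\<phi> ` W)" "\<phi> ` W \<noteq> {}"
proof -
  have "connected W" "smooth_on \<phi> W" "open (\<phi> ` W)"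
    using cc by (auto simp: canonical_coordinates_def diffeo_on_def)
  then show "open (\<phi> ` W)" "connected (\<phi> ` W)" "\<phi> ` W \<noteq> {}"
    using W(1) by (auto intro: connected_continuous_image smooth_on_continuous)
qed

lemma linear_push: "linear (push_field W \<phi>)"
  by (rule linear_push_field[OF W(4)])

lemma push_e1: "push_field W \<phi> e1 = restrict0 (\<phi> ` W) (\<lambda>_. (1, 0))"
  and push_e3: "push_field W \<phi> e3 = restrict0 (\<phi> ` W) (\<lambda>_. (0, 1))"
  using cc by (auto simp: canonical_coordinates_def)

lemma push_bracket: "X \<in> g \<Longrightarrow> Y \<in> g \<Longrightarrow> push_field W \<phi> (lie_bracket M X Y) =
    lie_bracket (\<phi> ` W) (push_field W \<phi> X) (push_field W \<phi> Y)"
  by (rule push_field_bracket[OF cc]) (auto intro: smooth_g e_in_g weights_e1)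

lemma push_differentiable: "X \<in> g \<Longrightarrow> q \<in> \<phi> ` W \<Longrightarrow> push_field W \<phi> X differentiable at q"
  by (rule push_field_differentiable[OF cc]) (auto intro: smooth_g e_in_g weights_e1)

lemma push_partial_derivatives:
  assumes "X \<in> g" "q \<in> \<phi> ` W"
  shows push_partial_x: "frechet_derivative (push_field W \<phi> X) (at q) (1, 0) =
      push_field W \<phi> (lie_bracket M e1 X) q"
    and push_partial_y: "frechet_derivative (push_field W \<phi> X) (at q) (0, 1) =
      push_field W \<phi> (lie_bracket M e3 X) q"
  using assms e_in_g
  by (simp_all add: push_bracket lie_bracket_at push_e1 push_e3
      frechet_derivative_restrict0_const[OF image(1)]) (simp_all add: restrict0_def)

text \<open>The eigenvalue equation together with \<open>[e3, X] = 0\<close> makes the pushed field \<open>e\<^bsup>ax\<^esup>\<close> times a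
  constant vector. Comparing with \<open>e3\<close> at one point of \<open>W\<close> where \<open>\<gg>'\<close> has rank one shows that this
  vector is vertical, and it is not zero because a field is determined by its germs.\<close>

lemma push_eigenvector:
  assumes X: "X \<in> D" "X \<noteq> 0" and ev: "lie_bracket M e1 X = a *\<^sub>R X"
  shows "\<exists>c. c \<noteq> 0 \<and> (\<forall>q\<in>\<phi> ` W. push_field W \<phi> X q = (0, c * exp (a * fst q)))"
proof -
  have Xg: "X \<in> g" using X D_subset by blast
  have "lie_bracket M e3 X = 0"
    using abelian_D X(1) e_in_D(1) by (auto simp: abelian_fields_def)
  then have "\<exists>c. \<forall>q\<in>\<phi> ` W. push_field W \<phi> X q = exp (a * fst q) *\<^sub>R c"
    by (intro solve_eigen_equation image push_differentiable Xg)
       (simp_all add: push_partial_x[OF Xg] push_partial_y[OF Xg] ev linear_scale[OF linear_push]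
         linear_0[OF linear_push] scaleR_fun_apply)
  then obtain c where c: "\<And>q. q \<in> \<phi> ` W \<Longrightarrow> push_field W \<phi> X q = exp (a * fst q) *\<^sub>R c" by blast
  have push: "frechet_derivative \<phi> (at p) (X p) = exp (a * fst (\<phi> p)) *\<^sub>R c" if "p \<in> W" for p
    using c[of "\<phi> p"] that by (simp add: push_field_at[OF W(4)])
  obtain G where G: "open G" "M \<subseteq> closure G" "\<forall>p\<in>G. orbit_has_dim M D p 1"
    using rank_D unfolding has_rank_def generic_in_def by blast
  have "W \<inter> G \<noteq> {}"
    using open_Int_closure_eq_empty[OF W(3), of G] W(1,2) G(2) by blast
  then obtain p where p: "p \<in> W" "p \<in> G" by blast
  have par: "plane_det (e3 p) (X p) = 0"
    by (rule parallel_where_rank_one) (use p G(3) e_in_D X in auto)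
  have lin: "linear (frechet_derivative \<phi> (at p))"
    using diffeo_on_has_derivative[OF W(4) p(1)] by (rule has_derivative_linear)
  have e3: "frechet_derivative \<phi> (at p) (e3 p) = (0, 1)"
    by (rule canonical_coordinates_frame(2)[OF cc p(1)])
  \<comment> \<open>\<open>X\<close> and \<open>e3\<close> are parallel at \<open>p\<close>, hence so are their images, one of which is \<open>\<partial>\<^sub>y\<close>.\<close>
  have "fst c = 0"
  proof (rule ccontr)
    assume "fst c \<noteq> 0"
    have "snd (X p) *\<^sub>R e3 p - snd (e3 p) *\<^sub>R X p = 0" "fst (X p) *\<^sub>R e3 p - fst (e3 p) *\<^sub>R X p = 0"
      using par by (auto simp: plane_det_def prod_eq_iff algebra_simps)
    then have "frechet_derivative \<phi> (at p) (snd (X p) *\<^sub>R e3 p - snd (e3 p) *\<^sub>R X p) = 0"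
      "frechet_derivative \<phi> (at p) (fst (X p) *\<^sub>R e3 p - fst (e3 p) *\<^sub>R X p) = 0"
      using linear_0[OF lin] by simp_all
    then have "snd (e3 p) = 0" "fst (e3 p) = 0"
      using \<open>fst c \<noteq> 0\<close>
      by (simp_all add: linear_diff[OF lin] linear_scale[OF lin] e3 push[OF p(1)] prod_eq_iff)
    then have "e3 p = 0" by (simp add: prod_eq_iff)
    then show False using e3 linear_0[OF lin] by (simp add: zero_prod_def)
  qed
  then have form: "push_field W \<phi> X q = (0, snd c * exp (a * fst q))" if "q \<in> \<phi> ` W" for q
    using c[OF that] by (simp add: prod_eq_iff mult.commute)
  have "snd c \<noteq> 0"
  proof
    assume "snd c = 0"
    then have "frechet_derivative \<phi> (at p) (X p) = 0" if "p \<in> W" for p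
      using push[OF that] \<open>fst c = 0\<close> by (simp add: prod_eq_iff)
    then have "X p = 0" if "p \<in> W" for p
      using diffeo_on_inv_derivative_left[OF W(4) that, of "X p"] that
        linear_0[OF has_derivative_linear[OF diffeo_on_inv_has_derivative[OF W(4) that]]] by simp
    then show False
      using alg Xg X(2) W(1-3) unfolding lie_algebra_of_fields_def by blast
  qed
  with form show ?thesis by blast
qed

text \<open>\<open>[e1, e2] = 0\<close> and \<open>[e3, e2] = - k e3\<close> give \<open>e2 = c\<^sub>1 \<partial>\<^sub>x + (c\<^sub>2 - k y) \<partial>\<^sub>y\<close>. That the weight of
  \<open>e2\<close> on \<open>e4\<close> is the same as on \<open>e3\<close> excludes the term \<open>c\<^sub>1 \<partial>\<^sub>x\<close>.\<close>

lemma push_e2: "\<exists>c. \<forall>q\<in>\<phi> ` W. push_field W \<phi> e2 q = (0, c - k * snd q)"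
proof -
  have "lie_bracket M e1 e2 = 0"
    using abelian_A e1A e2A by (auto simp: abelian_fields_def)
  moreover have "lie_bracket M e3 e2 = (- k) *\<^sub>R e3"
    using lie_bracket_antisym[of M e3 e2] weights_e2(1) by simp
  ultimately have "\<exists>c. \<forall>q\<in>\<phi> ` W. push_field W \<phi> e2 q = snd q *\<^sub>R ((- k) *\<^sub>R (0, 1)) + c"
    by (intro solve_affine_equation image push_differentiable e_in_g)
       (simp_all add: push_partial_x[OF e_in_g(2)] push_partial_y[OF e_in_g(2)]
         linear_scale[OF linear_push] linear_0[OF linear_push] scaleR_fun_apply push_e3
         linear_neg[OF linear_push] restrict0_def)
  then obtain c where "\<forall>q\<in>\<phi> ` W. push_field W \<phi> e2 q = snd q *\<^sub>R ((- k) *\<^sub>R (0, 1)) + c" by blast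
  then have c: "push_field W \<phi> e2 q = (fst c, snd c - k * snd q)" if "q \<in> \<phi> ` W" for q
    using that by (auto simp: prod_eq_iff)
  obtain c4 where c4: "c4 \<noteq> 0" "\<And>q. q \<in> \<phi> ` W \<Longrightarrow> push_field W \<phi> e4 q = (0, c4 * exp (lam * fst q))"
    using push_eigenvector[OF e_in_D(2) e_nonzero(2) weights_e1(2)] by blast
  obtain q where q: "q \<in> \<phi> ` W" using image(3) by blast
  let ?Y2 = "push_field W \<phi> e2" and ?Y4 = "push_field W \<phi> e4"
  have b34: "lie_bracket M e3 e4 = 0"
    using abelian_D e_in_D by (auto simp: abelian_fields_def)
  have D4: "frechet_derivative ?Y4 (at q) (?Y2 q) = (lam * fst c) *\<^sub>R ?Y4 q"
    using linear_plane_expand[OF linear_frechet_derivative[OF push_differentiable[OF e_in_g(4) q]], of "?Y2 q"]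
    by (simp add: push_partial_x[OF e_in_g(4) q] push_partial_y[OF e_in_g(4) q] b34 weights_e1(2)
        linear_scale[OF linear_push] linear_0[OF linear_push] scaleR_fun_apply c[OF q] mult.commute)
  have D2: "frechet_derivative ?Y2 (at q) (?Y4 q) = (- k) *\<^sub>R ?Y4 q"
    using linear_plane_expand[OF linear_frechet_derivative[OF push_differentiable[OF e_in_g(2) q]], of "?Y4 q"]
      lie_bracket_antisym[of M e3 e2] weights_e2(1) q
    by (simp add: push_partial_y[OF e_in_g(2) q] c4(2)[OF q]
        linear_scale[OF linear_push] linear_neg[OF linear_push] scaleR_fun_apply push_e3 restrict0_def)
  have "push_field W \<phi> (lie_bracket M e2 e4) q = k *\<^sub>R ?Y4 q"
    by (simp add: weights_e2(2) linear_scale[OF linear_push] scaleR_fun_apply)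
  then have "(lam * fst c) *\<^sub>R ?Y4 q + k *\<^sub>R ?Y4 q = k *\<^sub>R ?Y4 q"
    using q by (simp add: push_bracket[OF e_in_g(2,4)] lie_bracket_at D4 D2)
  then have "(lam * fst c) *\<^sub>R ?Y4 q = 0" by simp
  then have "fst c = 0" using nonzero(2) c4 q by (simp add: zero_prod_def)
  then show ?thesis using c by auto
qed

theorem push_algebra_eq_model: "push_field W \<phi> ` g = model_algebra (\<phi> ` W) lam mu"
proof -
  let ?U = "\<phi> ` W"
  let ?P = "push_field W \<phi>"
  let ?X = "restrict0 ?U (\<lambda>(x, y). (1, 0)) :: plane \<Rightarrow> plane"
    and ?Y = "restrict0 ?U (\<lambda>(x, y). (0, y)) :: plane \<Rightarrow> plane"
    and ?C = "restrict0 ?U (\<lambda>(x, y). (0, 1)) :: plane \<Rightarrow> plane"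
    and ?E = "\<lambda>a. restrict0 ?U (\<lambda>(x, y). (0, exp (a * x))) :: plane \<Rightarrow> plane"
  obtain c2 where c2: "\<And>q. q \<in> ?U \<Longrightarrow> ?P e2 q = (0, c2 - k * snd q)"
    using push_e2 by blast
  obtain c4 where c4: "c4 \<noteq> 0" "\<And>q. q \<in> ?U \<Longrightarrow> ?P e4 q = (0, c4 * exp (lam * fst q))"
    using push_eigenvector[OF e_in_D(2) e_nonzero(2) weights_e1(2)] by blast
  obtain c5 where c5: "c5 \<noteq> 0" "\<And>q. q \<in> ?U \<Longrightarrow> ?P e5 q = (0, c5 * exp (mu * fst q))"
    using push_eigenvector[OF e_in_D(3) e_nonzero(3) weights_e1(3)] by blast
  have eqI: "?P Z = Z'" if "\<And>q. q \<in> ?U \<Longrightarrow> ?P Z q = Z' q" "\<And>q. q \<notin> ?U \<Longrightarrow> Z' q = 0" for Z Z'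
  proof
    fix q
    show "?P Z q = Z' q"
      by (cases "q \<in> ?U") (simp_all add: that, simp add: push_field_def restrict0_def)
  qed
  have P1: "?P e1 = ?X" and P3: "?P e3 = ?C"
    by (auto simp: push_e1 push_e3 restrict0_def)
  have P2: "?P e2 = (- k) *\<^sub>R ?Y + c2 *\<^sub>R ?C"
    and P4: "?P e4 = c4 *\<^sub>R ?E lam" and P5: "?P e5 = c5 *\<^sub>R ?E mu"
    by (rule eqI; simp add: c2 c4(2) c5(2) restrict0_def scaleR_fun_apply split_def)+
  let ?S = "span {?X, (- k) *\<^sub>R ?Y + c2 *\<^sub>R ?C, ?C, c4 *\<^sub>R ?E lam, c5 *\<^sub>R ?E mu}"
  have h: "?P ` g = ?S"
    unfolding g_eq_span linear_span_image[OF linear_push, symmetric] by (simp add: P1 P2 P3 P4 P5)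
  have "?S = span ({?X, ?Y} \<union> {?C, ?E lam, ?E mu})"
    by (rule span_rescaled) (use nonzero(1) c4(1) c5(1) in auto)
  also have "\<dots> = {x + y |x y. x \<in> span {?X, ?Y} \<and> y \<in> span {?C, ?E lam, ?E mu}}"
    by (rule span_Un)
  also have "\<dots> = model_algebra ?U lam mu"
    using is_direct_sum_model[OF image(1,3), of lam mu] unfolding is_direct_sum_def by simp
  finally show ?thesis using h by simp
qed

end

end

section \<open>Prolongation of the model algebra\<close>

lemma open_jet_space:
  assumes "open U" shows "open (jet_space U)"
proof -
  have "jet_space U = (\<lambda>p. (fst p, fst (snd p))) -` U" by (auto simp: jet_space_def)
  moreover have "open ((\<lambda>p :: jet. (fst p, fst (snd p))) -` U)"
    by (intro open_vimage assms continuous_intros)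
  ultimately show ?thesis by simp
qed

lemma jet_coord_has_derivative:
  assumes "j \<le> 3" shows "(jet_coord j has_derivative jet_coord j) (at p)"
proof -
  consider "j = 0" | "j = 1" | "j = 2" | "j = 3" using assms by linarith
  then have "bounded_linear (jet_coord j)"
  proof cases
    case 1
    then have "jet_coord j = (\<lambda>p. fst (snd p))" by auto
    then show ?thesis by (auto intro!: bounded_linear_intros)
  next
    case 2
    then have "jet_coord j = (\<lambda>p. fst (snd (snd p)))" by auto
    then show ?thesis by (auto intro!: bounded_linear_intros)
  next
    case 3
    then have "jet_coord j = (\<lambda>p. fst (snd (snd (snd p))))" by auto
    then show ?thesis by (auto intro!: bounded_linear_intros)
  next
    case 4
    then have "jet_coord j = (\<lambda>p. snd (snd (snd (snd p))))" by auto
    then show ?thesis by (auto intro!: bounded_linear_intros)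
  qed
  then show ?thesis by (rule bounded_linear_imp_has_derivative)
qed

lemma total_deriv_eqI:
  assumes "open J" "(x, y, y1, y2, y3) \<in> J" "\<And>q. q \<in> J \<Longrightarrow> F q = G q"
    and "(G has_derivative G') (at (x, y, y1, y2, y3))"
  shows "total_deriv F (x, y, y1, y2, y3) = G' (1, y1, y2, y3, 0)"
proof -
  have "(F has_derivative G') (at (x, y, y1, y2, y3))"
    by (rule has_derivative_transform_within_open[OF assms(4,1,2)]) (simp add: assms(3))
  then show ?thesis by (simp add: frechet_derivative_eqI)
qed

text \<open>For a field \<open>a \<partial>\<^sub>x + (b y + f(x)) \<partial>\<^sub>y\<close> with constant \<open>a\<close> the correction term \<open>y\<^sup>(\<^sup>j\<^sup>) D\<xi>\<close> vanishes, so
  prolonging means differentiating \<open>b y + f(x)\<close> along curves. \<open>F i\<close> is the \<open>i\<close>-th derivative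
  of \<open>f\<close>.\<close>

lemma eta_affine_field:
  fixes F :: "nat \<Rightarrow> real \<Rightarrow> real"
  assumes U: "open U" and F: "\<And>i x. (F i has_real_derivative F (Suc i) x) (at x)"
    and j: "j \<le> 3" and p: "p \<in> jet_space U"
  shows "eta (restrict0 U (\<lambda>(x, y). (a, b * y + F 0 x))) j p = b * jet_coord j p + F j (fst p)"
  using j p
proof (induction j arbitrary: p)
  case 0
  then show ?case by (cases p) (auto simp: restrict0_def jet_space_def)
next
  case (Suc j)
  let ?Z = "restrict0 U (\<lambda>(x, y). (a, b * y + F 0 x))"
  obtain x y y1 y2 y3 where p: "p = (x, y, y1, y2, y3)" by (cases p) auto
  have "total_deriv (xi ?Z) (x, y, y1, y2, y3) = (\<lambda>_. 0) (1, y1, y2, y3, 0)"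
    by (rule total_deriv_eqI[OF open_jet_space[OF U], where G = "\<lambda>_. a"])
       (use Suc.prems p in \<open>auto simp: xi_def restrict0_def jet_space_def\<close>)
  moreover have "total_deriv (eta ?Z j) (x, y, y1, y2, y3) =
      (\<lambda>v. b * jet_coord j v + F (Suc j) x * fst v) (1, y1, y2, y3, 0)"
  proof (rule total_deriv_eqI[OF open_jet_space[OF U],
        where G = "\<lambda>q. b * jet_coord j q + F j (fst q)"])
    show "(x, y, y1, y2, y3) \<in> jet_space U" using Suc.prems p by simp
    show "eta ?Z j q = b * jet_coord j q + F j (fst q)" if "q \<in> jet_space U" for q
      using Suc.IH[OF _ that] Suc.prems by simp
    have "((\<lambda>q::jet. F j (fst q)) has_derivative (\<lambda>v. F (Suc j) x * fst v)) (at (x, y, y1, y2, y3))"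
      using has_derivative_compose[OF has_derivative_fst[OF has_derivative_ident],
          of "F j" "(*) (F (Suc j) x)" "(x, y, y1, y2, y3)" UNIV] F[of j x]
      by (simp add: has_field_derivative_def)
    then show "((\<lambda>q. b * jet_coord j q + F j (fst q)) has_derivative
        (\<lambda>v. b * jet_coord j v + F (Suc j) x * fst v)) (at (x, y, y1, y2, y3))"
      using Suc.prems(1)
      by (intro has_derivative_add has_derivative_mult_right jet_coord_has_derivative) auto
  qed
  moreover have "jet_coord j (1, y1, y2, y3, 0) = jet_coord (Suc j) (x, y, y1, y2, y3)"
  proof -
    consider "j = 0" | "j = 1" | "j = 2" using Suc.prems(1) by linarith
    then show ?thesis by cases auto
  qed
  ultimately show ?case by (simp add: p)
qed

lemma prolong3_model_field:
  assumes "open U" "(x, y, y1, y2, y3) \<in> jet_space U"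
  shows "prolong3 U (model_field U lam mu a b c d m) (x, y, y1, y2, y3) =
    (a, b * y + c + d * exp (lam * x) + m * exp (mu * x),
     b * y1 + d * lam * exp (lam * x) + m * mu * exp (mu * x),
     b * y2 + d * lam^2 * exp (lam * x) + m * mu^2 * exp (mu * x),
     b * y3 + d * lam^3 * exp (lam * x) + m * mu^3 * exp (mu * x))"
proof -
  define F where "F i x = (if i = 0 then c else 0) + d * lam^i * exp (lam * x) + m * mu^i * exp (mu * x)"
    for i :: nat and x
  have F: "(F i has_real_derivative F (Suc i) x) (at x)" for i x
    unfolding F_def by (auto intro!: derivative_eq_intros)
  have Z: "model_field U lam mu a b c d m = restrict0 U (\<lambda>(x, y). (a, b * y + F 0 x))"
    by (simp add: model_field_def F_def)
  note eta = eta_affine_field[where F = F and a = a and b = b, OF assms(1) F _ assms(2)]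
  have xi: "xi (model_field U lam mu a b c d m) (x, y, y1, y2, y3) = a"
    using assms(2) by (simp add: xi_def model_field_def restrict0_def jet_space_def)
  show ?thesis
    using assms(2) eta[of 0] eta[of 1] eta[of 2] eta[of 3] xi unfolding Z
    by (simp add: prolong3_def restrict0_def F_def numeral_2_eq_2 numeral_3_eq_3 del: eta.simps)
qed

text \<open>The left-hand side of \<open>y''' - (\<lambda> + \<mu>) y'' + \<lambda>\<mu> y' = 0\<close>, written as an inner product with its
  normal vector. It is applied both to points of the extended space and to tangent vectors.\<close>

definition third_order_form :: "real \<Rightarrow> real \<Rightarrow> jet \<Rightarrow> real"
  where "third_order_form lam mu v = (0, 0, lam * mu, - (lam + mu), 1) \<bullet> v"

lemma third_order_form_eq:
  "third_order_form lam mu (v0, v1, v2, v3, v4) = v4 - (lam + mu) * v3 + lam * mu * v2"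
  by (simp add: third_order_form_def algebra_simps)

text \<open>The form annihilates the prolongations of all generators but \<open>y \<partial>\<^sub>y\<close>, whose
  prolongation reproduces the jet coordinates of the point.\<close>

lemma third_order_form_prolong:
  assumes "open U" "p \<in> jet_space U"
  shows "third_order_form lam mu (prolong3 U (model_field U lam mu a b c d m) p) =
    b * third_order_form lam mu p"
  by (cases p) (use assms in \<open>auto simp: prolong3_model_field third_order_form_eq algebra_simps
      power2_eq_square power3_eq_cube\<close>)

definition third_order_kernel :: "real \<Rightarrow> real \<Rightarrow> jet set"
  where "third_order_kernel lam mu = {v. third_order_form lam mu v = 0}"

lemma subspace_third_order_kernel: "subspace (third_order_kernel lam mu)"
  and dim_third_order_kernel: "dim (third_order_kernel lam mu) = 4"
proof -
  have "(0, 0, lam * mu, - (lam + mu), 1) \<noteq> (0 :: jet)" by (simp add: zero_prod_def)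
  then have "dim {v :: jet. (0, 0, lam * mu, - (lam + mu), 1) \<bullet> v = 0} = DIM(jet) - 1"
    by (rule dim_hyperplane)
  then show "dim (third_order_kernel lam mu) = 4"
    by (simp add: third_order_kernel_def third_order_form_def)
  show "subspace (third_order_kernel lam mu)"
    unfolding third_order_kernel_def third_order_form_def by (rule subspace_hyperplane)
qed

text \<open>The coefficients \<open>a\<close> and \<open>c\<close> are free to match the first two components, \<open>d\<close> and \<open>m\<close> match the
  next two, and the condition on the form is what the last component requires.\<close>

lemma kernel_prolongation_exists:
  assumes "open U" "p \<in> jet_space U" "lam \<noteq> 0" "mu \<noteq> 0" "lam \<noteq> mu"
    and v: "third_order_form lam mu v = b * third_order_form lam mu p"
  shows "\<exists>Z \<in> model_algebra U lam mu. prolong3 U Z p = v"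
proof -
  obtain x y y1 y2 y3 where p: "p = (x, y, y1, y2, y3)" by (cases p) auto
  obtain v0 v1 v2 v3 v4 where v': "v = (v0, v1, v2, v3, v4)" by (cases v) auto
  \<comment> \<open>Cramer's rule for \<open>\<lambda>P + \<mu>Q = r\<close>, \<open>\<lambda>\<^sup>2P + \<mu>\<^sup>2Q = s\<close> with \<open>P = d e\<^bsup>\<lambda>x\<^esup>\<close>, \<open>Q = m e\<^bsup>\<mu>x\<^esup>\<close>.\<close>
  define r s where "r = v2 - b * y1" and "s = v3 - b * y2"
  define d where "d = (mu * r - s) / (lam * (mu - lam) * exp (lam * x))"
  define m where "m = (s - lam * r) / (mu * (mu - lam) * exp (mu * x))"
  define c where "c = v1 - b * y - d * exp (lam * x) - m * exp (mu * x)"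
  define P Q where "P = d * exp (lam * x)" and "Q = m * exp (mu * x)"
  have "lam * P = (mu * r - s) / (mu - lam)" "mu * Q = (s - lam * r) / (mu - lam)"
    unfolding P_def Q_def d_def m_def using assms(3-5) by (simp_all add: divide_simps)
  then have eq1: "lam * P + mu * Q = r"
    using assms(5) by (simp add: add_divide_distrib[symmetric]) (simp add: field_simps)
  have eq2: "lam^2 * P + mu^2 * Q = s"
  proof -
    have "lam^2 * P + mu^2 * Q = lam * ((mu * r - s) / (mu - lam)) + mu * ((s - lam * r) / (mu - lam))"
      using \<open>lam * P = _\<close> \<open>mu * Q = _\<close> by (metis mult.assoc power2_eq_square)
    also have "\<dots> = s" using assms(5) by (simp add: divide_simps) (simp add: algebra_simps)
    finally show ?thesis .
  qed
  have eq3: "lam^3 * P + mu^3 * Q = (lam + mu) * s - lam * mu * r"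
    unfolding eq1[symmetric] eq2[symmetric] by (simp add: algebra_simps power2_eq_square power3_eq_cube)
  have v4: "v4 = b * y3 + ((lam + mu) * s - lam * mu * r)"
    using v by (simp add: p v' third_order_form_eq r_def s_def algebra_simps)
  have "prolong3 U (model_field U lam mu v0 b c d m) p = v"
    using assms(1,2) eq1 eq2 eq3
    by (simp add: p v' prolong3_model_field v4)
      (simp add: c_def r_def s_def P_def Q_def algebra_simps)
  then show ?thesis unfolding model_algebra_def by blast
qed

lemma prolongation_values:
  assumes "open U" "p \<in> jet_space U" "lam \<noteq> 0" "mu \<noteq> 0" "lam \<noteq> mu"
  shows "(\<lambda>X. X p) ` prolong3 U ` model_algebra U lam mu =
    (if third_order_form lam mu p = 0 then third_order_kernel lam mu else UNIV)"
proof -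
  have iff: "v \<in> (\<lambda>X. X p) ` prolong3 U ` model_algebra U lam mu \<longleftrightarrow>
      (\<exists>b. third_order_form lam mu v = b * third_order_form lam mu p)" for v
  proof
    assume "v \<in> (\<lambda>X. X p) ` prolong3 U ` model_algebra U lam mu"
    then show "\<exists>b. third_order_form lam mu v = b * third_order_form lam mu p"
      using third_order_form_prolong[OF assms(1,2)] unfolding model_algebra_def by blast
  next
    assume "\<exists>b. third_order_form lam mu v = b * third_order_form lam mu p"
    then show "v \<in> (\<lambda>X. X p) ` prolong3 U ` model_algebra U lam mu"
      using kernel_prolongation_exists[OF assms] by blast
  qed
  have "\<exists>b. r = b * s" if "s \<noteq> 0" for r s :: real
    using that by (intro exI[of _ "r / s"]) simp
  then show ?thesis
    by (intro set_eqI) (simp only: iff, simp add: third_order_kernel_def)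
qed

section \<open>Orbits and invariant hypersurfaces of the model algebra\<close>

lemma hyperplane_complement_dense:
  fixes a :: "'a::euclidean_space"
  assumes "open J" "a \<noteq> 0"
  shows "J \<subseteq> closure (J \<inter> {v. a \<bullet> v \<noteq> 0})"
proof -
  have "interior {v. a \<bullet> v = 0} = {}" using assms(2) by (rule interior_hyperplane)
  then have "closure {v. a \<bullet> v \<noteq> 0} = UNIV"
    by (simp add: closure_interior Collect_neg_eq[symmetric])
  then show ?thesis using open_Int_closure_subset[OF assms(1), of "{v. a \<bullet> v \<noteq> 0}"] by simp
qed

locale model_domain =
  fixes U :: "plane set" and lam mu :: real
  assumes U: "open U" "connected U" "U \<noteq> {}"
    and weights: "lam \<noteq> 0" "mu \<noteq> 0" "lam \<noteq> mu"
begin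

abbreviation J where "J \<equiv> jet_space U"
abbreviation S where "S \<equiv> third_order_kernel lam mu \<inter> J"
abbreviation h where "h \<equiv> model_algebra U lam mu"

lemma open_J: "open J"
  by (rule open_jet_space[OF U(1)])

lemma values_S:
  assumes "p \<in> S" shows "(\<lambda>X. X p) ` prolong3 U ` h = third_order_kernel lam mu"
proof -
  have "p \<in> J" "third_order_form lam mu p = 0" using assms by (auto simp: third_order_kernel_def)
  then show ?thesis using prolongation_values[OF U(1) _ weights, of p] by simp
qed

lemma values_complement:
  assumes "p \<in> J - S" shows "(\<lambda>X. X p) ` prolong3 U ` h = UNIV"
proof -
  have "p \<in> J" "third_order_form lam mu p \<noteq> 0" using assms by (auto simp: third_order_kernel_def)
  then show ?thesis using prolongation_values[OF U(1) _ weights, of p] by simp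
qed

lemma open_complement: "open (J - S)"
proof -
  have "J - S = J - third_order_kernel lam mu" by blast
  then show ?thesis
    using open_J closed_subspace[OF subspace_third_order_kernel] by (simp add: open_Diff)
qed

lemma orbit_S: "p \<in> S \<Longrightarrow> orbit_has_dim J (prolong3 U ` h) p 4"
  using orbit_has_dim_slice[OF open_J order_refl subspace_third_order_kernel, of p lam mu "prolong3 U ` h"]
    values_S by (simp add: dim_third_order_kernel)

lemma orbit_complement:
  assumes "p \<in> J - S" shows "orbit_has_dim J (prolong3 U ` h) p 5"
proof -
  have "orbit_has_dim J (prolong3 U ` h) p (dim (UNIV :: jet set))"
    by (rule orbit_has_dim_slice[OF open_complement Diff_subset subspace_UNIV])
       (use assms in \<open>auto simp only: Int_UNIV_left values_complement\<close>)
  moreover have "dim (UNIV :: jet set) = 5" by simp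
  ultimately show ?thesis by (simp only:)
qed

lemma orbit_dim_unique:
  assumes "orbit_has_dim J (prolong3 U ` h) p d" "p \<in> J"
  shows "d = (if p \<in> S then 4 else 5)"
proof (cases "p \<in> S")
  case True
  then show ?thesis
    using dim_values_orbit(2)[OF assms(1)] values_S[OF True] by (simp add: dim_third_order_kernel)
next
  case False
  then show ?thesis
    using dim_values_orbit(2)[OF assms(1)] values_complement[of p] assms(2) by simp
qed

lemma rank_five: "has_rank J (prolong3 U ` h) 5"
  unfolding has_rank_def generic_in_def
proof (intro exI conjI ballI)
  let ?a = "(0, 0, lam * mu, - (lam + mu), 1) :: jet"
  have "?a \<noteq> 0" by (simp add: zero_prod_def)
  then have "J \<subseteq> closure (J \<inter> {v. ?a \<bullet> v \<noteq> 0})" by (rule hyperplane_complement_dense[OF open_J])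
  also have "J \<inter> {v. ?a \<bullet> v \<noteq> 0} = J - S"
    by (auto simp: third_order_kernel_def third_order_form_def)
  finally show "J \<subseteq> closure (J - S)" .
  show "orbit_has_dim J (prolong3 U ` h) p 5" if "p \<in> J - S" for p
    by (rule orbit_complement[OF that])
qed (use open_complement in auto)

lemma low_dimensional_orbits: "{p \<in> J. \<exists>d<5. orbit_has_dim J (prolong3 U ` h) p d} = S"
proof (intro equalityI subsetI)
  fix p assume "p \<in> {p \<in> J. \<exists>d<5. orbit_has_dim J (prolong3 U ` h) p d}"
  then obtain d where "p \<in> J" "d < 5" "orbit_has_dim J (prolong3 U ` h) p d" by blast
  then show "p \<in> S" using orbit_dim_unique[of p d] by (cases "p \<in> S") simp_all
next
  fix p assume p: "p \<in> S"
  have "(4::nat) < 5" by simp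
  then show "p \<in> {p \<in> J. \<exists>d<5. orbit_has_dim J (prolong3 U ` h) p d}"
    using orbit_S[OF p] p by blast
qed

lemma five_dimensional_orbits: "{p \<in> J. orbit_has_dim J (prolong3 U ` h) p 5} = J - S"
proof (intro equalityI subsetI)
  fix p assume "p \<in> {p \<in> J. orbit_has_dim J (prolong3 U ` h) p 5}"
  then show "p \<in> J - S" using orbit_dim_unique[of p 5] by (cases "p \<in> S") simp_all
qed (use orbit_complement in blast)

text \<open>Over each point of \<open>U\<close> the hypersurface is the graph of \<open>y'''\<close> as a function of \<open>y', y''\<close>, so
  it is connected because \<open>U\<close> is.\<close>

lemma S_eq_image: "S = (\<lambda>((x, y), y1, y2). (x, y, y1, y2, (lam + mu) * y2 - lam * mu * y1)) ` (U \<times> UNIV)"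
proof (intro equalityI subsetI)
  fix p assume p: "p \<in> S"
  obtain x y y1 y2 y3 where p': "p = (x, y, y1, y2, y3)" by (cases p) auto
  have "(x, y) \<in> U" "y3 = (lam + mu) * y2 - lam * mu * y1"
    using p by (auto simp: p' third_order_kernel_def third_order_form_eq jet_space_def)
  then show "p \<in> (\<lambda>((x, y), y1, y2). (x, y, y1, y2, (lam + mu) * y2 - lam * mu * y1)) ` (U \<times> UNIV)"
    by (intro image_eqI[of _ _ "((x, y), y1, y2)"]) (auto simp: p')
qed (auto simp: third_order_kernel_def third_order_form_eq jet_space_def)

lemma connected_S: "connected S"
  unfolding S_eq_image
  by (intro connected_continuous_image connected_Times U(2) connected_UNIV)
     (auto simp: split_def intro!: continuous_intros)

lemma S_nonempty: "S \<noteq> {}"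
  unfolding S_eq_image using U(3) by auto

lemma DIM_jet_minus_one: "DIM(jet) - 1 = 4"
  by simp

lemma hypersurface_invariant_S: "invariant_hypersurface U h S"
  unfolding invariant_hypersurface_def hypersurface_in_def DIM_jet_minus_one
proof (intro conjI ballI)
  show "submanifold 4 S"
    using submanifold_slice[OF open_J subspace_third_order_kernel, of lam mu]
    by (simp add: dim_third_order_kernel)
  show "prolong3 U Z p \<in> tangent_space S p" if "Z \<in> h" "p \<in> S" for Z p
    using tangent_space_slice[OF open_J subspace_third_order_kernel that(2)] values_S[OF that(2)] that(1)
    by blast
qed (use S_nonempty in auto)

text \<open>Outside \<open>S\<close> the prolonged fields span all directions, too many to be tangent to a
  hypersurface. So an invariant hypersurface lies in \<open>S\<close>, and having the same dimension it is
  relatively open there.\<close>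

lemma invariant_hypersurface_subset_S:
  assumes H: "invariant_hypersurface U h H"
  shows "H \<subseteq> S" "openin (top_of_set S) H" "closedin (top_of_set J) H \<Longrightarrow> H = S"
proof -
  have HJ: "H \<subseteq> J" "H \<noteq> {}" "submanifold 4 H"
    and tangent: "\<And>Z p. Z \<in> h \<Longrightarrow> p \<in> H \<Longrightarrow> prolong3 U Z p \<in> tangent_space H p"
    using H unfolding invariant_hypersurface_def hypersurface_in_def DIM_jet_minus_one by blast+
  show sub: "H \<subseteq> S"
  proof (rule ccontr)
    assume "\<not> H \<subseteq> S"
    then obtain p where p: "p \<in> H" "p \<in> J - S" using HJ(1) by blast
    have "(\<lambda>X. X p) ` prolong3 U ` h \<subseteq> tangent_space H p"
      using tangent[OF _ p(1)] by (intro image_subsetI) (elim imageE, simp)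
    then have "tangent_space H p = UNIV" unfolding values_complement[OF p(2)] by (rule top_le)
    then show False using dim_tangent_space[OF HJ(3) p(1)] by simp
  qed
  have "openin (top_of_set (third_order_kernel lam mu)) H"
    by (rule submanifold_openin_subspace)
       (use HJ(3) sub subspace_third_order_kernel in \<open>auto simp: dim_third_order_kernel\<close>)
  then show op: "openin (top_of_set S) H" by (rule openin_subset_trans) (use sub in auto)
  show "H = S" if "closedin (top_of_set J) H"
  proof -
    have "closedin (top_of_set S) H" by (rule closedin_subset_trans[OF that]) (use sub in auto)
    then show ?thesis using connected_S op HJ(2) unfolding connected_clopen by blast
  qed
qed

end

lemma third_order_kernel_Int:
  "third_order_kernel lam mu \<inter> J = {(x, y, y1, y2, y3) \<in> J. y3 - (lam + mu) * y2 + lam * mu * y1 = 0}"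
  by (auto simp: third_order_kernel_def third_order_form_eq)

theorem theorem4p2:
  fixes M :: "plane set"
    and g A :: "(plane \<Rightarrow> plane) set"
    and e1 e2 e3 e4 e5 :: "plane \<Rightarrow> plane"
    and k lam mu :: real
  assumes "lie_algebra_of_fields M g" and "dim g = 5"
    and "abelian_fields M (derived_algebra M g)" and "has_rank M (derived_algebra M g) 1"
    and "is_direct_sum g A (derived_algebra M g)" and "abelian_fields M A"
    and "e1 \<in> A" and "e2 \<in> A" and "quotient_basis g (derived_algebra M g) e1 e2"
    and "weight_vector M (derived_algebra M g) e1 e2 (0, k) e3"
    and "weight_vector M (derived_algebra M g) e1 e2 (lam, k) e4"
    and "weight_vector M (derived_algebra M g) e1 e2 (mu, k) e5"
    and "k \<noteq> 0" and "lam \<noteq> 0" and "mu \<noteq> 0" and "lam \<noteq> mu"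
    and "has_rank M (span (insert e3 (centralizer M A e3))) 2"
  shows "generic_in M (\<lambda>p. \<exists>W \<phi>. p \<in> W \<and> canonical_coordinates M e1 e3 W \<phi>) \<and>
    (\<forall>W \<phi>. canonical_coordinates M e1 e3 W \<phi> \<longrightarrow>
      (let U = \<phi> ` W;
           h = push_field W \<phi> ` g;
           J = jet_space U;
           S = {(x, y, y1, y2, y3) \<in> J. y3 - (lam + mu) * y2 + lam * mu * y1 = 0}
       in is_direct_sum h
            (span {restrict0 U (\<lambda>(x, y). (1, 0)), restrict0 U (\<lambda>(x, y). (0, y))})
            (span {restrict0 U (\<lambda>(x, y). (0, 1)),
                   restrict0 U (\<lambda>(x, y). (0, exp (lam * x))),
                   restrict0 U (\<lambda>(x, y). (0, exp (mu * x)))}) \<and>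
          has_rank J (prolong3 U ` h) 5 \<and>
          {p \<in> J. \<exists>d<5. orbit_has_dim J (prolong3 U ` h) p d} = S \<and>
          {p \<in> J. orbit_has_dim J (prolong3 U ` h) p 5} = J - S \<and>
          invariant_hypersurface U h S \<and>
          (\<forall>H. invariant_hypersurface U h H \<longrightarrow>
             H \<subseteq> S \<and> openin (top_of_set S) H \<and> (closedin (top_of_set J) H \<longrightarrow> H = S))))"
proof -
  interpret planar_weight_algebra M g A e1 e2 e3 e4 e5 k lam mu
    by (unfold_locales) (fact assms)+
  show ?thesis
  proof (intro conjI allI impI generic_canonical_coordinates)
    fix W \<phi> assume cc: "canonical_coordinates M e1 e3 W \<phi>"
    note img = image[OF cc]
    interpret model_domain "\<phi> ` W" lam mu
      using img nonzero by unfold_locales auto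
    show "let U = \<phi> ` W;
           h = push_field W \<phi> ` g;
           J = jet_space U;
           S = {(x, y, y1, y2, y3) \<in> J. y3 - (lam + mu) * y2 + lam * mu * y1 = 0}
       in is_direct_sum h
            (span {restrict0 U (\<lambda>(x, y). (1, 0)), restrict0 U (\<lambda>(x, y). (0, y))})
            (span {restrict0 U (\<lambda>(x, y). (0, 1)),
                   restrict0 U (\<lambda>(x, y). (0, exp (lam * x))),
                   restrict0 U (\<lambda>(x, y). (0, exp (mu * x)))}) \<and>
          has_rank J (prolong3 U ` h) 5 \<and>
          {p \<in> J. \<exists>d<5. orbit_has_dim J (prolong3 U ` h) p d} = S \<and>
          {p \<in> J. orbit_has_dim J (prolong3 U ` h) p 5} = J - S \<and>
          invariant_hypersurface U h S \<and>
          (\<forall>H. invariant_hypersurface U h H \<longrightarrow>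
             H \<subseteq> S \<and> openin (top_of_set S) H \<and> (closedin (top_of_set J) H \<longrightarrow> H = S))"
      unfolding Let_def push_algebra_eq_model[OF cc] third_order_kernel_Int[symmetric]
      by (intro conjI allI impI is_direct_sum_model[OF img(1,3)] rank_five low_dimensional_orbits
          five_dimensional_orbits hypersurface_invariant_S invariant_hypersurface_subset_S) assumption+
  qed
qed

end
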